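(* Let $V\in\mathcal{V}^{4}_{\delta_4}$ for some integer $1/\delta_4\in[4,+\infty)$, and let $\rho>0$, $\lambda>0$ be constants such that $$\frac{\rho}{2}\big(1+V(x)\big)^{\rho-2}\Big[2\big(1+V(x)\big)\mathcal{L}V(x)+(\rho-1)\big|D^{(1)}V(x)g(x)\big|^2\Big]\le \lambda\big[1+V^{\rho}(x)\big]\qquad\forall x\in\mathbb{R}^d .$$ Assume moreover that $V(\epsilon x)\le V(x)$ for all $x\in\mathbb{R}^d$ and $0<\epsilon\le 1$. Then for every $T>0$ there is a constant $C>0$, independent of $k$ and $\Delta$, such that the truncated Euler--Maruyama scheme $\{Y_k\}$ (defined in the context from $V$) satisfies $$\sup_{\Delta\in(0,\Delta^*]}\ \sup_{0\le k\Delta\le T}\mathbb{E}\,V^{\rho}(Y_k)\le C .$$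
   Context: **SDE.** $|\cdot|$ is the Euclidean norm on $\mathbb{R}^d$ and the trace (Frobenius) norm on matrices; $\bar{\mathbb{R}}_+=[0,\infty)$; $a\vee b=\max\{a,b\}$, $a\wedge b=\min\{a,b\}$. On a complete filtered probability space $(\Omega,\mathcal{F},\{\mathcal{F}_t\}_{t\ge0},\mathbb{P})$ satisfying the usual conditions, $B(t)$ is an $m$-dimensional $\mathcal{F}_t$-Brownian motion. Consider $\mathrm{d}X(t)=f(X(t))\mathrm{d}t+g(X(t))\mathrm{d}B(t)$, $X(0)=x_0\in\mathbb{R}^d$, where $f:\mathbb{R}^d\to\mathbb{R}^d$, $g:\mathbb{R}^d\to\mathbb{R}^{d\times m}$ are locally Lipschitz continuous. **Lyapunov functions.** $\mathcal{C}^p_\infty(\mathbb{R}^d;\bar{\mathbb{R}}_+)$ is the set of nonnegative $p$-times continuously differentiable functions $V$ on $\mathbb{R}^d$ with $V(x)\to\infty$ as $|x|\to\infty$. For a multiindex $\alpha$, $D^\alpha V$ is the usual partial derivative; $|D^{(n)}V(x)|=\big(\sum_{|\alpha|=n}|D^\alpha V(x)|^2\big)^{1/2}$ for the set $D^{(n)}V$ of $n$th order partial derivatives; $D^{(1)}V$ is the gradient regarded as a row vector and $D^{(2)}V$ the Hessian matrix (with $|D^{(2)}V|$ its Frobenius norm). For integers $p\ge2$ and $1/\delta_p\ge p$, $$\mathcal{V}^{p}_{\delta_p}=\Big\{V\in\mathcal{C}^p_\infty(\mathbb{R}^d;\bar{\mathbb{R}}_+): \exists c>0,\ |D^{(n)}V(\cdot)|\le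 c(1+V(\cdot))^{1-n\delta_p},\ n=1,\dots,p\Big\}.$$ The operator is $\mathcal{L}V(x)=\langle D^{(1)}V(x),f(x)\rangle+\frac12\mathrm{tr}[g^T(x)D^{(2)}V(x)g(x)]$. (The left side of the condition in the claim equals $\mathcal{L}(1+V(x))^\rho$.) **Scheme.** Choose a strictly increasing continuous $\varphi:\bar{\mathbb{R}}_+\to\bar{\mathbb{R}}_+$ with $\varphi(u)\to\infty$ as $u\to\infty$ and $$\sup_{|x|\le u}\left(\frac{|f(x)|}{(1+V(x))^{\delta_4}}\vee\frac{|g(x)|^2}{(1+V(x))^{2\delta_4}}\right)\le\varphi(u)\qquad\forall u\ge1,$$ with inverse $\varphi^{-1}:[\varphi(1),\infty)\to\bar{\mathbb{R}}_+$. Choose $0<\theta\le 1/2$ and constants $\Delta^*\in(0,1]$, $K>0$ with $K(\Delta^* )^{-\theta}\ge\varphi(|x_0|\vee1)$ ($K$ independent of $k$ and $\Delta$). For $\Delta\in(0,\Delta^*]$ put $\pi_\Delta(x)=\big(|x|\wedge\varphi^{-1}(K\Delta^{-\theta})\big)\frac{x}{|x|}$ (with $x/|x|=\mathbf{0}$ for $x=\mathbf{0}$), $t_k=k\Delta$, $\Delta B_k=B(t_{k+1})-B(t_k)$, and for integers $k\ge0$ $$Y_0=x_0,\quad \tilde Y_{k+1}=Y_k+f(Y_k)\Delta+g(Y_k)\Delta B_k,\quad Y_{k+1}=\pi_\Delta(\tilde Y_{k+1}).$$ *)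

theory Defs
  imports "HOL-Probability.Probability"
begin

subsection \<open>Partial derivatives and the Lyapunov classes\<close>

definition partial :: "'d::finite \<Rightarrow> (real^'d \<Rightarrow> real) \<Rightarrow> real^'d \<Rightarrow> real" where
  "partial i V x = frechet_derivative V (at x) (axis i 1)"

primrec C_diff :: "nat \<Rightarrow> (real^'d::finite \<Rightarrow> real) \<Rightarrow> bool" where
  "C_diff 0 V \<longleftrightarrow> continuous_on UNIV V"
| "C_diff (Suc p) V \<longleftrightarrow> (\<forall>x. V differentiable (at x)) \<and> (\<forall>i. C_diff p (partial i V))"

text \<open>
  A multiindex is a function \<open>\<alpha> :: 'd \<Rightarrow> nat\<close> with \<open>|\<alpha>| = sum \<alpha> UNIV\<close>. The type \<open>'d\<close> carries
  no order, so the derivatives are taken in an arbitrary order; for functions of class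
  \<open>C\<close> of order \<open>|\<alpha>|\<close>, the only ones to which this is applied, the order is immaterial.
\<close>

definition mpartial :: "('d::finite \<Rightarrow> nat) \<Rightarrow> (real^'d \<Rightarrow> real) \<Rightarrow> real^'d \<Rightarrow> real" where
  "mpartial \<alpha> V = foldr partial (SOME is. \<forall>i. count_list is i = \<alpha> i) V"

lemma multiindex_list_exists:
  fixes \<alpha> :: "'d::finite \<Rightarrow> nat"
  shows "\<exists>is. \<forall>i. count_list is i = \<alpha> i"
proof -
  have "\<exists>is. \<forall>i. count_list is i = (if i \<in> A then \<alpha> i else 0)" if "finite A" for A :: "'d set"
    using that
  proof (induction A)
    case empty
    show ?case by (rule exI[of _ "[]"]) simp
  next
    case (insert a A)
    then obtain xs where xs: "\<forall>i. count_list xs i = (if i \<in> A then \<alpha> i else 0)" by blast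
    have "count_list (replicate n a) i = (if i = a then n else 0)" for n i
      by (induction n) auto
    then have "\<forall>i. count_list (replicate (\<alpha> a) a @ xs) i = (if i \<in> insert a A then \<alpha> i else 0)"
      using xs insert.hyps by simp
    then show ?case by blast
  qed
  from this[of UNIV] show ?thesis by simp
qed

lemma finite_multiindices: "finite {\<alpha> :: 'd::finite \<Rightarrow> nat. sum \<alpha> UNIV = n}"
proof (rule finite_subset)
  show "{\<alpha> :: 'd \<Rightarrow> nat. sum \<alpha> UNIV = n} \<subseteq> PiE UNIV (\<lambda>_. {..n})"
  proof
    fix \<alpha> :: "'d \<Rightarrow> nat" assume "\<alpha> \<in> {\<alpha>. sum \<alpha> UNIV = n}"
    then have "\<alpha> i \<le> n" for i using member_le_sum[of i UNIV \<alpha>] by simp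
    then show "\<alpha> \<in> PiE UNIV (\<lambda>_. {..n})" by (simp add: PiE_UNIV_domain)
  qed
  show "finite (PiE UNIV (\<lambda>_ :: 'd. {..n}))"
    by (rule finite_PiE) simp_all
qed

definition gradient :: "(real^'d::finite \<Rightarrow> real) \<Rightarrow> real^'d \<Rightarrow> real^'d" where
  "gradient V x = (\<chi> i. partial i V x)"

definition hessian :: "(real^'d::finite \<Rightarrow> real) \<Rightarrow> real^'d \<Rightarrow> real^'d^'d" where
  "hessian V x = (\<chi> i j. partial i (partial j V) x)"

text \<open>
  The norm of the set of \<open>n\<close>th order derivatives. For \<open>n = 2\<close> it is the Frobenius norm of the
  Hessian (which is \<^const>\<open>norm\<close> on the matrix type), counting mixed derivatives twice; in
  \<open>lyapunov_class\<close> the constant \<open>c\<close> absorbs the difference.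
\<close>

definition deriv_norm :: "nat \<Rightarrow> (real^'d::finite \<Rightarrow> real) \<Rightarrow> real^'d \<Rightarrow> real" where
  "deriv_norm n V x =
     (if n = 2 then norm (hessian V x)
      else sqrt (\<Sum>\<alpha> | sum \<alpha> UNIV = n. (mpartial \<alpha> V x)\<^sup>2))"

definition lyapunov_class :: "nat \<Rightarrow> real \<Rightarrow> (real^'d::finite \<Rightarrow> real) set" where
  "lyapunov_class p \<delta> = {V. C_diff p V \<and> (\<forall>x. 0 \<le> V x) \<and> filterlim V at_top at_infinity \<and>
     (\<exists>c>0. \<forall>n\<in>{1..p}. \<forall>x. deriv_norm n V x \<le> c * (1 + V x) powr (1 - real n * \<delta>))}"

text \<open>A \<open>d \<times> m\<close> matrix has type \<open>real^'m^'d\<close> (rows indexed by \<open>'d\<close>).\<close>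

definition generator ::
  "(real^'d::finite \<Rightarrow> real^'d) \<Rightarrow> (real^'d \<Rightarrow> real^'m::finite^'d) \<Rightarrow> (real^'d \<Rightarrow> real) \<Rightarrow> real^'d \<Rightarrow> real" where
  "generator f g V x =
     inner (gradient V x) (f x) + 1/2 * trace (transpose (g x) ** hessian V x ** g x)"

subsection \<open>Filtered probability spaces and Brownian motion\<close>

text \<open>Time is \<open>[0,\<infinity>)\<close>: only the values of \<open>F\<close> and \<open>B\<close> at nonnegative reals are relevant.\<close>

definition filtered_prob_space_usual :: "'a measure \<Rightarrow> (real \<Rightarrow> 'a measure) \<Rightarrow> bool" where
  "filtered_prob_space_usual M F \<longleftrightarrow>
     prob_space M \<and>
     (\<forall>A N. N \<in> null_sets M \<and> A \<subseteq> N \<longrightarrow> A \<in> sets M) \<and>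
     (\<forall>t\<ge>0. subalgebra M (F t)) \<and>
     (\<forall>s t. 0 \<le> s \<and> s \<le> t \<longrightarrow> sets (F s) \<subseteq> sets (F t)) \<and>
     null_sets M \<subseteq> sets (F 0) \<and>
     (\<forall>t\<ge>0. sets (F t) = (\<Inter>s\<in>{t<..}. sets (F s)))"

text \<open>The increments over \<open>[s,t]\<close> are centred Gaussian with covariance \<open>(t - s) I\<close>.\<close>

definition brownian_motion ::
  "'a measure \<Rightarrow> (real \<Rightarrow> 'a measure) \<Rightarrow> (real \<Rightarrow> 'a \<Rightarrow> real^'m::finite) \<Rightarrow> bool" where
  "brownian_motion M F B \<longleftrightarrow>
     (\<forall>t\<ge>0. B t \<in> borel_measurable (F t)) \<and>
     (AE \<omega> in M. B 0 \<omega> = 0) \<and>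
     (AE \<omega> in M. continuous_on {0..} (\<lambda>t. B t \<omega>)) \<and>
     (\<forall>s t. 0 \<le> s \<and> s < t \<longrightarrow>
        prob_space.indep_set M (sets (F s)) {(\<lambda>\<omega>. B t \<omega> - B s \<omega>) -` A \<inter> space M | A. A \<in> sets borel} \<and>
        distributed M lborel (\<lambda>\<omega>. B t \<omega> - B s \<omega>)
          (\<lambda>x. ennreal (\<Prod>i\<in>UNIV. normal_density 0 (sqrt (t - s)) (x $ i))))"

subsection \<open>The truncated Euler--Maruyama scheme\<close>

text \<open>
  \<open>inv_into {0..} \<phi>\<close> is the inverse of \<open>\<phi>\<close> on \<open>[0,\<infinity>)\<close>; as \<open>inverse 0 = 0\<close>, \<open>x /\<^sub>R norm x\<close> is
  \<open>0\<close> for \<open>x = 0\<close>.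
\<close>

definition truncation ::
  "(real \<Rightarrow> real) \<Rightarrow> real \<Rightarrow> real \<Rightarrow> real \<Rightarrow> real^'d::finite \<Rightarrow> real^'d" where
  "truncation \<phi> K \<theta> \<Delta> x =
     min (norm x) (inv_into {0..} \<phi> (K * \<Delta> powr (- \<theta>))) *\<^sub>R (x /\<^sub>R norm x)"

primrec truncated_EM ::
  "(real^'d::finite \<Rightarrow> real^'d) \<Rightarrow> (real^'d \<Rightarrow> real^'m::finite^'d) \<Rightarrow> (real \<Rightarrow> 'a \<Rightarrow> real^'m) \<Rightarrow> real^'d \<Rightarrow>
   (real \<Rightarrow> real) \<Rightarrow> real \<Rightarrow> real \<Rightarrow> real \<Rightarrow> nat \<Rightarrow> 'a \<Rightarrow> real^'d" where
  "truncated_EM f g B x0 \<phi> K \<theta> \<Delta> 0 \<omega> = x0"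
| "truncated_EM f g B x0 \<phi> K \<theta> \<Delta> (Suc k) \<omega> =
     (let Y = truncated_EM f g B x0 \<phi> K \<theta> \<Delta> k \<omega> in
      truncation \<phi> K \<theta> \<Delta>
        (Y + \<Delta> *\<^sub>R f Y + g Y *v (B (real (Suc k) * \<Delta>) \<omega> - B (real k * \<Delta>) \<omega>)))"

end

theory Submission
  imports Defs
begin

text \<open>
  Write \<open>U = 1 + V\<close>, \<open>G = U powr \<delta>\<^sub>4\<close> and \<open>W = U powr \<rho>\<close>. Everything follows from a
  one-step estimate: from every point \<open>y\<close> that the truncated scheme can visit, one untruncated Euler--Maruyama step
  raises the mean of \<open>W\<close> at most by a factor \<open>1 + C \<Delta>\<close> (\<open>one_step_moment_bound\<close>). The
  truncation moves points towards the origin, where \<open>V\<close> is not larger, and the Brownian increment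
  is independent of the past, so induction on \<open>k\<close> gives the mean of \<open>W(Y\<^sub>k)\<close> the bound
  \<open>(1 + C \<Delta>) ^ k * W(x\<^sub>0) \<le> exp (C T) * W(x\<^sub>0)\<close>.

  The step is \<open>a + b\<close> with drift \<open>a = \<Delta> f(y)\<close> and noise \<open>b = g(y) \<xi>\<close>, where \<open>\<xi>\<close> is Gaussian
  with covariance \<open>\<Delta>\<close> times the identity. With \<open>h = K \<Delta> powr (-\<theta>)\<close>, the growth
  condition at a truncated point reads \<open>|f| \<le> h G\<close> and \<open>|g|\<^sup>2 \<le> h G\<^sup>2\<close>. With \<open>\<eta> = sqrt (h \<Delta>)\<close> this says that
  \<open>|a|\<close> is at most \<open>\<eta>\<^sup>2 G\<close> and \<open>|b|\<close> at most \<open>\<eta> G\<close> times a normalised Gaussian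
  length. As \<open>\<theta> \<le> 1/2\<close>, \<open>\<eta> ^ 4 \<le> K\<^sup>2 \<Delta>\<close>, so every contribution of order \<open>\<eta> ^ 4\<close> is
  harmless, but those of order \<open>\<eta>\<close>, \<open>\<eta>\<^sup>2\<close> and \<open>\<eta>\<^sup>3\<close> have to be dealt with. Replacing
  \<open>W(y + a + b)\<close> by the mean of \<open>W(y + a + b)\<close> and \<open>W(y + a - b)\<close>, which does not change the
  expectation, removes the orders that are odd in \<open>b\<close>. What remains below order four is the
  derivative of \<open>W\<close> along \<open>a\<close> and half its second derivative along \<open>b\<close>; their expectation is
  \<open>\<Delta>\<close> times the generator applied to \<open>W\<close>, and the hypothesis bounds it by \<open>2 lam \<Delta> W(y)\<close>.

  The remainders are controlled by the scaling of the Lyapunov class: for \<open>n \<le> 4\<close>, an \<open>n\<close>-th derivative of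
  \<open>W\<close> is at most a constant times \<open>W / G ^ n\<close>, because the class is stable under products and
  powers (\<open>symbol_powr\<close>). For \<open>n = 1\<close> and the function \<open>G\<close> itself this says that \<open>G\<close> is
  Lipschitz. Hence \<open>G\<close> stays within a factor 2 along a step that is short compared with
  \<open>G(y)\<close>, and Taylor's formula applies there. On a longer step, the product \<open>e\<close> of
  \<open>\<eta>\<close> and one plus the normalised Gaussian length is bounded below by a positive constant, so a
  crude bound, polynomial in \<open>e\<close>, may be multiplied by a constant times \<open>e ^ 4\<close>
  (\<open>symbol_symmetric_step\<close>).
\<close>

section \<open>Symmetry of mixed partial derivatives\<close>

lemma has_derivative_sum_partial:
  fixes h :: "real^'d::finite \<Rightarrow> real"
  assumes "h differentiable at x"
  shows "(h has_derivative (\<lambda>v. \<Sum>i\<in>UNIV. v $ i * partial i h x)) (at x)"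
proof -
  let ?F = "frechet_derivative h (at x)"
  have D: "(h has_derivative ?F) (at x)"
    using assms frechet_derivative_works by blast
  then interpret linear ?F
    by (rule has_derivative_linear)
  have "?F v = (\<Sum>i\<in>UNIV. v $ i * partial i h x)" for v
  proof -
    have "?F v = ?F (\<Sum>i\<in>UNIV. v $ i *\<^sub>R axis i 1)"
      using basis_expansion[of v] by (simp add: scalar_mult_eq_scaleR)
    also have "\<dots> = (\<Sum>i\<in>UNIV. v $ i * partial i h x)"
      by (simp add: sum scale partial_def)
    finally show ?thesis .
  qed
  with D show ?thesis
    by (metis (no_types, lifting) ext)
qed

lemma partial_eqI:
  assumes "(h has_derivative h') (at x)"
  shows "partial i h x = h' (axis i 1)"
  using frechet_derivative_at[OF assms] by (simp add: partial_def)

definition dir_deriv :: "real^'d \<Rightarrow> (real^'d::finite \<Rightarrow> real) \<Rightarrow> real^'d \<Rightarrow> real" where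
  "dir_deriv v h x = (\<Sum>i\<in>UNIV. v $ i * partial i h x)"

lemma dir_deriv_axis [simp]: "dir_deriv (axis i 1) h = partial i h"
  by (auto simp: dir_deriv_def axis_def if_distrib[of "\<lambda>z. z * _"] cong: if_cong)

lemma DERIV_along_line:
  assumes "\<And>x. h differentiable at x"
  shows "((\<lambda>t. h (p + t *\<^sub>R v)) has_real_derivative dir_deriv v h (p + s *\<^sub>R v)) (at s)"
proof -
  have "((\<lambda>t. h (p + t *\<^sub>R v)) has_derivative
      (\<lambda>t. \<Sum>i\<in>UNIV. (t *\<^sub>R v) $ i * partial i h (p + s *\<^sub>R v))) (at s)"
    by (rule has_derivative_compose[OF _ has_derivative_sum_partial[OF assms]])
       (auto intro!: derivative_eq_intros)
  also have "(\<lambda>t. \<Sum>i\<in>UNIV. (t *\<^sub>R v) $ i * partial i h (p + s *\<^sub>R v)) =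
      (*) (dir_deriv v h (p + s *\<^sub>R v))"
    by (auto simp: fun_eq_iff dir_deriv_def sum_distrib_left mult_ac)
  finally show ?thesis
    by (simp add: has_field_derivative_def)
qed

lemma DERIV_along_axis:
  assumes "\<And>x. h differentiable at x"
  shows "((\<lambda>t. h (p + t *\<^sub>R axis i 1)) has_real_derivative partial i h (p + s *\<^sub>R axis i 1)) (at s)"
  using DERIV_along_line[OF assms, of p "axis i 1" s] by simp

lemma C_diff_continuous:
  assumes "C_diff n h"
  shows "continuous_on UNIV h"
proof (cases n)
  case (Suc m)
  with assms have "\<And>x. h differentiable at x" by simp
  then show ?thesis
    by (intro continuous_at_imp_continuous_on ballI differentiable_imp_continuous_within)
qed (use assms in simp)

lemma C_diff_Suc_imp: "C_diff (Suc n) h \<Longrightarrow> C_diff n h"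
proof (induction n arbitrary: h)
  case 0
  then show ?case using C_diff_continuous[of "Suc 0" h] by simp
qed (simp only: C_diff.simps, blast)

lemma C_diff_mono: "C_diff n h \<Longrightarrow> m \<le> n \<Longrightarrow> C_diff m h"
proof (induction n)
  case (Suc n)
  then show ?case by (cases "m = Suc n") (auto simp del: C_diff.simps intro: C_diff_Suc_imp)
qed simp

lemma C_diff_foldr_partial:
  "C_diff (length is + n) h \<Longrightarrow> C_diff n (foldr partial is h)"
proof (induction "is" arbitrary: n)
  case (Cons i "is")
  then have "C_diff (Suc n) (foldr partial is h)"
    by (intro Cons.IH) (simp only: length_Cons add_Suc add_Suc_right)
  then show ?case by simp
qed simp

text \<open>
  Two applications of the mean value theorem, first in direction \<open>i\<close> and then in direction \<open>j\<close>.
  The left-hand side is symmetric in \<open>i\<close> and \<open>j\<close>, which is where the equality of mixed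
  derivatives comes from.
\<close>

lemma second_difference:
  fixes h :: "real^'d::finite \<Rightarrow> real"
  assumes "C_diff 2 h" "t > 0"
  shows "\<exists>\<xi>. norm (\<xi> - x) \<le> 2 * t \<and>
     h (x + t *\<^sub>R axis i 1 + t *\<^sub>R axis j 1) - h (x + t *\<^sub>R axis i 1) - h (x + t *\<^sub>R axis j 1) + h x
       = t\<^sup>2 * partial j (partial i h) \<xi>"
proof -
  let ?ei = "axis i 1 :: real^'d" and ?ej = "axis j 1 :: real^'d"
  have diff: "\<And>x. h differentiable at x" "\<And>x. partial i h differentiable at x"
    using assms(1) by (auto simp: numeral_2_eq_2)
  let ?\<phi> = "\<lambda>s. h ((x + t *\<^sub>R ?ej) + s *\<^sub>R ?ei) - h (x + s *\<^sub>R ?ei)"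
  have "\<exists>z. 0 < z \<and> z < t \<and> ?\<phi> t - ?\<phi> 0 = (t - 0) *
      (partial i h ((x + t *\<^sub>R ?ej) + z *\<^sub>R ?ei) - partial i h (x + z *\<^sub>R ?ei))"
    by (rule MVT2[OF \<open>t > 0\<close>])
       (rule DERIV_diff DERIV_along_axis diff(1))+
  then obtain z where z: "0 < z" "z < t" "?\<phi> t - ?\<phi> 0 = t *
      (partial i h ((x + t *\<^sub>R ?ej) + z *\<^sub>R ?ei) - partial i h (x + z *\<^sub>R ?ei))" by auto
  let ?\<psi> = "\<lambda>s. partial i h ((x + z *\<^sub>R ?ei) + s *\<^sub>R ?ej)"
  have "\<exists>w. 0 < w \<and> w < t \<and> ?\<psi> t - ?\<psi> 0 = (t - 0) * 
      partial j (partial i h) ((x + z *\<^sub>R ?ei) + w *\<^sub>R ?ej)"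
    by (rule MVT2[OF \<open>t > 0\<close>]) (rule DERIV_along_axis diff(2))+
  then obtain w where w: "0 < w" "w < t" "?\<psi> t - ?\<psi> 0 = t * 
      partial j (partial i h) ((x + z *\<^sub>R ?ei) + w *\<^sub>R ?ej)" by auto
  show ?thesis
  proof (intro exI conjI)
    have "norm (z *\<^sub>R ?ei + w *\<^sub>R ?ej) \<le> z + w"
      using norm_triangle_ineq[of "z *\<^sub>R ?ei" "w *\<^sub>R ?ej"] z w by simp
    then show "norm ((x + z *\<^sub>R ?ei) + w *\<^sub>R ?ej - x) \<le> 2 * t"
      using z w by (simp add: algebra_simps)
    show "h (x + t *\<^sub>R ?ei + t *\<^sub>R ?ej) - h (x + t *\<^sub>R ?ei) - h (x + t *\<^sub>R ?ej) + h x
       = t\<^sup>2 * partial j (partial i h) ((x + z *\<^sub>R ?ei) + w *\<^sub>R ?ej)"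
      using z(3) w(3) by (simp add: algebra_simps power2_eq_square)
  qed
qed

lemma partial_commute:
  fixes h :: "real^'d::finite \<Rightarrow> real"
  assumes "C_diff 2 h"
  shows "partial i (partial j h) = partial j (partial i h)"
proof
  fix x
  let ?t = "\<lambda>n::nat. 1 / real (Suc n)"
  let ?D = "\<lambda>t. h (x + t *\<^sub>R axis i 1 + t *\<^sub>R axis j 1) - h (x + t *\<^sub>R axis i 1)
      - h (x + t *\<^sub>R axis j 1) + h x"
  have t: "?t \<longlonglongrightarrow> 0"
    by (rule LIMSEQ_Suc[OF lim_1_over_n])
  have lim: "(\<lambda>n. ?D (?t n) / (?t n)\<^sup>2) \<longlonglongrightarrow> partial l (partial k h) x"
    if D: "\<And>t. t > 0 \<Longrightarrow> \<exists>\<xi>. norm (\<xi> - x) \<le> 2 * t \<and> ?D t = t\<^sup>2 * partial l (partial k h) \<xi>" for k l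
  proof -
    have "\<forall>n. \<exists>\<xi>. norm (\<xi> - x) \<le> 2 * ?t n \<and> ?D (?t n) = (?t n)\<^sup>2 * partial l (partial k h) \<xi>"
      by (intro allI D) simp
    then obtain \<xi> where \<xi>: "\<And>n. norm (\<xi> n - x) \<le> 2 * ?t n"
      and eq: "\<And>n. ?D (?t n) = (?t n)\<^sup>2 * partial l (partial k h) (\<xi> n)"
      by metis
    have "(\<lambda>n. \<xi> n - x) \<longlonglongrightarrow> 0"
      by (rule tendsto_0_le[where K=2, OF t]) (use \<xi> in \<open>auto simp: mult.commute\<close>)
    then have "\<xi> \<longlonglongrightarrow> x"
      by (rule LIM_zero_cancel)
    moreover have "isCont (partial l (partial k h)) x"
      using assms by (auto simp: numeral_2_eq_2 continuous_on_eq_continuous_at)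
    ultimately have "(\<lambda>n. partial l (partial k h) (\<xi> n)) \<longlonglongrightarrow> partial l (partial k h) x"
      by (rule isCont_tendsto_compose[rotated])
    moreover have "?D (?t n) / (?t n)\<^sup>2 = partial l (partial k h) (\<xi> n)" for n
      unfolding eq by simp
    ultimately show ?thesis by (simp only:)
  qed
  have "(\<lambda>n. ?D (?t n) / (?t n)\<^sup>2) \<longlonglongrightarrow> partial j (partial i h) x"
    by (rule lim) (rule second_difference[OF assms])
  moreover have "(\<lambda>n. ?D (?t n) / (?t n)\<^sup>2) \<longlonglongrightarrow> partial i (partial j h) x"
    by (rule lim) (use second_difference[OF assms, of _ x j i] in \<open>auto simp: algebra_simps\<close>)
  ultimately show "partial i (partial j h) x = partial j (partial i h) x"
    by (rule LIMSEQ_unique[rotated])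
qed

lemma foldr_partial_to_front:
  assumes "C_diff (length xs + Suc (length ys)) h"
  shows "foldr partial (xs @ i # ys) h = foldr partial (i # xs @ ys) h"
  using assms
proof (induction xs)
  case (Cons x xs)
  have "C_diff (length xs + Suc (length ys)) h"
    by (rule C_diff_mono[OF Cons.prems]) simp
  from Cons.IH[OF this] have "foldr partial (xs @ i # ys) h = partial i (foldr partial (xs @ ys) h)"
    by (simp only: foldr.simps o_apply)
  then have "foldr partial ((x # xs) @ i # ys) h =
      partial x (partial i (foldr partial (xs @ ys) h))"
    by (simp only: append_Cons foldr.simps o_apply)
  also have "C_diff 2 (foldr partial (xs @ ys) h)"
    by (rule C_diff_foldr_partial, rule C_diff_mono[OF Cons.prems]) simp
  then have "partial x (partial i (foldr partial (xs @ ys) h)) =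
      partial i (partial x (foldr partial (xs @ ys) h))"
    by (rule partial_commute)
  finally show ?case by (simp only: append_Cons foldr.simps o_apply)
qed simp

text \<open>
  The multiindex derivatives behind \<^const>\<open>deriv_norm\<close> are taken in an unspecified order. This
  lemma makes their bounds available for every order, so that no multiindex appears below.
\<close>

lemma foldr_partial_permute:
  assumes "mset is = mset js" "C_diff (length is) h"
  shows "foldr partial is h = foldr partial js h"
  using assms
proof (induction "is" arbitrary: js)
  case (Cons i "is")
  have "i \<in> set js"
    using mset_eq_setD[OF Cons.prems(1)] by auto
  then obtain xs ys where js: "js = xs @ i # ys"
    by (meson split_list)
  with Cons.prems(1) have eq: "mset is = mset (xs @ ys)" by simp
  have len: "length is = length xs + length ys"
    using mset_eq_length[OF eq] by simp
  have "C_diff (length is) h"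
    by (rule C_diff_Suc_imp) (use Cons.prems(2) in \<open>simp only: length_Cons\<close>)
  from Cons.IH[OF eq this] have "foldr partial (i # is) h = foldr partial (i # xs @ ys) h"
    by (simp only: length_Cons foldr.simps o_apply)
  also have "\<dots> = foldr partial js h"
    unfolding js by (rule foldr_partial_to_front[symmetric]) (use Cons.prems(2) len in \<open>simp only: length_Cons add_Suc_right\<close>)
  finally show ?case .
qed simp

lemma abs_foldr_partial_le_deriv_norm:
  fixes h :: "real^'d::finite \<Rightarrow> real"
  assumes "C_diff (length is) h"
  shows "\<bar>foldr partial is h x\<bar> \<le> deriv_norm (length is) h x"
proof (cases "length is = 2")
  case True
  then obtain i j where ij: "is = [i, j]"
    by (auto simp: numeral_2_eq_2 length_Suc_conv)
  have "\<bar>hessian h x $ i $ j\<bar> \<le> norm (hessian h x)"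
    using Finite_Cartesian_Product.norm_nth_le[of "hessian h x $ i" j]
      Finite_Cartesian_Product.norm_nth_le[of "hessian h x" i] by simp
  then show ?thesis
    by (simp add: True deriv_norm_def) (simp add: ij hessian_def)
next
  case False
  let ?\<alpha> = "count_list is"
  define js where "js = (SOME js. \<forall>i. count_list js i = ?\<alpha> i)"
  have js: "\<forall>i. count_list js i = ?\<alpha> i"
    unfolding js_def by (rule someI[of _ "is"]) simp
  have "mset is = mset js"
    using js by (simp add: multiset_eq_iff count_mset)
  then have eq: "foldr partial is h = mpartial ?\<alpha> h"
    unfolding mpartial_def js_def[symmetric] using assms by (rule foldr_partial_permute)
  have "sum ?\<alpha> UNIV = sum ?\<alpha> (set is)"
    by (rule sum.mono_neutral_right) (auto simp: count_list_0_iff)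
  then have sum: "sum ?\<alpha> UNIV = length is"
    by (simp add: sum_count_set)
  have "(mpartial ?\<alpha> h x)\<^sup>2 \<le> (\<Sum>\<alpha> | sum \<alpha> UNIV = length is. (mpartial \<alpha> h x)\<^sup>2)"
    by (rule member_le_sum) (auto simp: sum finite_multiindices)
  from real_sqrt_le_mono[OF this]
  have "\<bar>mpartial ?\<alpha> h x\<bar> \<le> sqrt (\<Sum>\<alpha> | sum \<alpha> UNIV = length is. (mpartial \<alpha> h x)\<^sup>2)"
    by simp
  with False show ?thesis
    by (simp add: deriv_norm_def eq)
qed

section \<open>Functions with the scaling of the Lyapunov class\<close>

text \<open>
  A symbol class as in microlocal analysis, with an arbitrary weight \<open>G\<close>: the function has order
  \<open>r\<close>, and each of its first \<open>n\<close> derivatives lowers the order by one. The constant \<open>c\<close> is explicit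
  because directional derivatives along vectors of varying length have to be estimated uniformly.
\<close>

primrec symbol :: "(real^'d \<Rightarrow> real) \<Rightarrow> real \<Rightarrow> nat \<Rightarrow> real \<Rightarrow> (real^'d::finite \<Rightarrow> real) \<Rightarrow> bool" where
  "symbol G c 0 r h \<longleftrightarrow> (\<forall>x. \<bar>h x\<bar> \<le> c * G x powr r)"
| "symbol G c (Suc n) r h \<longleftrightarrow> (\<forall>x. \<bar>h x\<bar> \<le> c * G x powr r) \<and> (\<forall>x. h differentiable at x) \<and>
     (\<forall>i. symbol G c n (r - 1) (partial i h))"

lemma symbol_bound: "symbol G c n r h \<Longrightarrow> \<bar>h x\<bar> \<le> c * G x powr r"
  by (cases n) auto

lemma symbol_Suc_imp: "symbol G c (Suc n) r h \<Longrightarrow> symbol G c n r h"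
proof (induction n arbitrary: r h)
  case (Suc n)
  note S = Suc.prems[unfolded symbol.simps(2)[of G c "Suc n"]]
  then have "symbol G c n (r - 1) (partial i h)" for i
    by (intro Suc.IH) blast
  with S show ?case
    by (simp only: symbol.simps(2)[of G c n]) blast
qed simp

lemma symbol_mono_order: "symbol G c n r h \<Longrightarrow> m \<le> n \<Longrightarrow> symbol G c m r h"
proof (induction n)
  case (Suc n)
  show ?case
  proof (cases "m = Suc n")
    case False
    with Suc.prems have "m \<le> n" by simp
    then show ?thesis by (rule Suc.IH[OF symbol_Suc_imp[OF Suc.prems(1)]])
  qed (use Suc.prems in \<open>simp only:\<close>)
qed simp

lemma symbol_mono_const:
  assumes "c \<le> c'"
  shows "symbol G c n r h \<Longrightarrow> symbol G c' n r h"
proof (induction n arbitrary: r h)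
  have le: "c * G x powr s \<le> c' * G x powr s" for x s
    using assms by (rule mult_right_mono) simp
  {
    case 0
    then show ?case using le by (auto intro: order_trans)
  next
    case (Suc n)
    then show ?case using le by (auto intro: order_trans)
  }
qed

lemma partial_lincomb:
  assumes "\<And>j x. j \<in> A \<Longrightarrow> h j differentiable at x"
  shows "partial i (\<lambda>x. \<Sum>j\<in>A. a j * h j x) = (\<lambda>x. \<Sum>j\<in>A. a j * partial i (h j) x)"
    and "(\<lambda>x. \<Sum>j\<in>A. a j * h j x) differentiable at x"
proof -
  have D: "((\<lambda>x. \<Sum>j\<in>A. a j * h j x) has_derivative
      (\<lambda>v. \<Sum>j\<in>A. a j * (\<Sum>i\<in>UNIV. v $ i * partial i (h j) x))) (at x)" for x
    by (intro has_derivative_sum has_derivative_mult_right has_derivative_sum_partial assms)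
  show "partial i (\<lambda>x. \<Sum>j\<in>A. a j * h j x) = (\<lambda>x. \<Sum>j\<in>A. a j * partial i (h j) x)"
    unfolding partial_eqI[OF D] fun_eq_iff
    using dir_deriv_axis[of i, unfolded fun_eq_iff dir_deriv_def] by simp
  show "(\<lambda>x. \<Sum>j\<in>A. a j * h j x) differentiable at x"
    using D differentiable_def by blast
qed

lemma symbol_lincomb:
  assumes "finite A" "\<And>j. j \<in> A \<Longrightarrow> symbol G c n r (h j)"
  shows "symbol G (c * (\<Sum>j\<in>A. \<bar>a j\<bar>)) n r (\<lambda>x. \<Sum>j\<in>A. a j * h j x)"
  using assms(2)
proof (induction n arbitrary: r h)
  have bound: "\<bar>\<Sum>j\<in>A. a j * h j x\<bar> \<le> c * (\<Sum>j\<in>A. \<bar>a j\<bar>) * G x powr r"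
    if "\<And>j. j \<in> A \<Longrightarrow> \<bar>h j x\<bar> \<le> c * G x powr r" for h r x
  proof -
    have "\<bar>\<Sum>j\<in>A. a j * h j x\<bar> \<le> (\<Sum>j\<in>A. \<bar>a j\<bar> * \<bar>h j x\<bar>)"
      by (rule order_trans[OF sum_abs]) (simp add: abs_mult)
    also have "\<dots> \<le> (\<Sum>j\<in>A. \<bar>a j\<bar> * (c * G x powr r))"
      by (intro sum_mono mult_left_mono that) auto
    also have "\<dots> = c * (\<Sum>j\<in>A. \<bar>a j\<bar>) * G x powr r"
      by (simp add: sum_distrib_left sum_distrib_right mult_ac)
    finally show ?thesis .
  qed
  {
    case 0
    then show ?case using bound by simp
  next
    case (Suc n)
    from Suc.prems have diff: "\<And>j x. j \<in> A \<Longrightarrow> h j differentiable at x"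
      by simp
    have "symbol G (c * (\<Sum>j\<in>A. \<bar>a j\<bar>)) n (r - 1) (\<lambda>x. \<Sum>j\<in>A. a j * partial i (h j) x)" for i
      by (rule Suc.IH) (use Suc.prems in simp)
    then show ?case
      using bound Suc.prems partial_lincomb[where a=a, OF diff] by simp
  }
qed

lemma symbol_dir_deriv:
  assumes "symbol G c (Suc n) r h"
  shows "symbol G (c * (\<Sum>i\<in>UNIV. \<bar>v $ i\<bar>)) n (r - 1) (dir_deriv v h)"
proof -
  have "symbol G (c * (\<Sum>i\<in>UNIV. \<bar>v $ i\<bar>)) n (r - 1) (\<lambda>x. \<Sum>i\<in>UNIV. v $ i * partial i h x)"
    by (rule symbol_lincomb) (use assms in auto)
  then show ?thesis
    unfolding dir_deriv_def .
qed

lemma symbol_dir_deriv_funpow: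
  "symbol G c (m + n) r h \<Longrightarrow>
     symbol G (c * (\<Sum>i\<in>UNIV. \<bar>v $ i\<bar>) ^ m) n (r - real m) ((dir_deriv v ^^ m) h)"
proof (induction m arbitrary: n)
  case (Suc m)
  then have "symbol G (c * (\<Sum>i\<in>UNIV. \<bar>v $ i\<bar>) ^ m) (Suc n) (r - real m) ((dir_deriv v ^^ m) h)"
    by (simp only: add_Suc add_Suc_right)
  from symbol_dir_deriv[OF this, of v] show ?case
    by (simp add: algebra_simps)
qed simp

lemma symbol_add:
  assumes "symbol G c n r h" "symbol G c' n r h'"
  shows "symbol G (c + c') n r (\<lambda>x. h x + h' x)"
  using assms
proof (induction n arbitrary: r h h')
  have bound: "\<bar>h x + h' x\<bar> \<le> (c + c') * G x powr r"
    if "\<bar>h x\<bar> \<le> c * G x powr r" "\<bar>h' x\<bar> \<le> c' * G x powr r" for h h' r x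
    using abs_triangle_ineq[of "h x" "h' x"] that by (simp add: algebra_simps)
  {
    case 0
    then show ?case using bound by simp
  next
    case (Suc n)
    have D: "((\<lambda>x. h x + h' x) has_derivative (\<lambda>v. (\<Sum>i\<in>UNIV. v $ i * partial i h x) +
        (\<Sum>i\<in>UNIV. v $ i * partial i h' x))) (at x)" for x
      by (intro has_derivative_add has_derivative_sum_partial) (use Suc.prems in auto)
    have "partial i (\<lambda>x. h x + h' x) = (\<lambda>x. partial i h x + partial i h' x)" for i
      unfolding partial_eqI[OF D] fun_eq_iff
      using dir_deriv_axis[of i, unfolded fun_eq_iff dir_deriv_def] by simp
    moreover have "\<And>x. (\<lambda>x. h x + h' x) differentiable at x"
      using D differentiable_def by blast
    ultimately show ?case
      using bound Suc by simp
  }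
qed

lemma partial_mult:
  assumes "\<And>x. h differentiable at x" "\<And>x. h' differentiable at x"
  shows "partial i (\<lambda>x. h x * h' x) = (\<lambda>x. h x * partial i h' x + partial i h x * h' x)"
proof
  fix x
  have D: "((\<lambda>x. h x * h' x) has_derivative (\<lambda>v. h x * (\<Sum>i\<in>UNIV. v $ i * partial i h' x) +
        (\<Sum>i\<in>UNIV. v $ i * partial i h x) * h' x)) (at x)" for x
    by (intro has_derivative_mult has_derivative_sum_partial assms)
  show "partial i (\<lambda>x. h x * h' x) x = h x * partial i h' x + partial i h x * h' x"
    unfolding partial_eqI[OF D]
    using dir_deriv_axis[of i, unfolded fun_eq_iff dir_deriv_def] by simp
qed

text \<open>
  By Leibniz's rule each derivative doubles the number of terms, hence the factor \<open>2 ^ n\<close>.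
\<close>

lemma symbol_mult:
  assumes "symbol G c n r h" "symbol G c' n r' h'" "0 \<le> c" "0 \<le> c'"
  shows "symbol G (2 ^ n * c * c') n (r + r') (\<lambda>x. h x * h' x)"
  using assms(1,2)
proof (induction n arbitrary: r r' h h')
  have bound: "\<bar>h x * h' x\<bar> \<le> 2 ^ n * c * c' * G x powr (r + r')"
    if "\<bar>h x\<bar> \<le> c * G x powr r" "\<bar>h' x\<bar> \<le> c' * G x powr r'" for h h' r r' x n
  proof -
    have "\<bar>h x * h' x\<bar> \<le> (c * G x powr r) * (c' * G x powr r')"
      unfolding abs_mult by (rule mult_mono[OF that]) (use assms(3) in auto)
    also have "\<dots> = 1 * (c * c' * G x powr (r + r'))"
      by (simp add: powr_add)
    also have "\<dots> \<le> 2 ^ n * (c * c' * G x powr (r + r'))"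
      by (rule mult_right_mono) (use assms(3,4) in auto)
    finally show ?thesis by (simp add: mult_ac)
  qed
  {
    case 0
    then show ?case using bound[of h _ r h' r' 0] by simp
  next
    case (Suc n)
    from Suc.prems have diff: "\<And>x. h differentiable at x" "\<And>x. h' differentiable at x"
      by auto
    have "symbol G (2 ^ n * c * c' + 2 ^ n * c * c') n (r + r' - 1)
        (\<lambda>x. h x * partial i h' x + partial i h x * h' x)" for i
    proof (rule symbol_add)
      show "symbol G (2 ^ n * c * c') n (r + r' - 1) (\<lambda>x. h x * partial i h' x)"
        using Suc.IH[OF symbol_Suc_imp[OF Suc.prems(1)], of "r' - 1" "partial i h'"] Suc.prems(2)
        by (simp add: algebra_simps)
      show "symbol G (2 ^ n * c * c') n (r + r' - 1) (\<lambda>x. partial i h x * h' x)"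
        using Suc.IH[OF _ symbol_Suc_imp[OF Suc.prems(2)], of "r - 1" "partial i h"] Suc.prems(1)
        by (simp add: algebra_simps)
    qed
    then have "symbol G (2 ^ Suc n * c * c') n (r + r' - 1) (partial i (\<lambda>x. h x * h' x))" for i
      unfolding partial_mult[OF diff] by (simp add: mult_ac)
    moreover have "(\<lambda>x. h x * h' x) differentiable at x" for x
      by (rule differentiable_mult) (rule diff)+
    ultimately show ?case
      using bound[of h _ r h' r' "Suc n"] Suc.prems by simp
  }
qed

lemma partial_powr:
  assumes "\<And>x. U differentiable at x" "\<And>x. U x > 0"
  shows "partial i (\<lambda>x. U x powr s) = (\<lambda>x. s * U x powr (s - 1) * partial i U x)"
    and "(\<lambda>x. U x powr s) differentiable at x"
proof -
  have D: "((\<lambda>x. U x powr s) has_derivative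
      (\<lambda>v. s * U x powr (s - 1) * (\<Sum>i\<in>UNIV. v $ i * partial i U x))) (at x)" for x
  proof -
    have "((\<lambda>u. u powr s) has_derivative (\<lambda>v. s * U x powr (s - 1) * v)) (at (U x))"
      using has_real_derivative_powr[OF assms(2)[of x], of s]
      by (simp add: has_field_derivative_def)
    from has_derivative_compose[OF has_derivative_sum_partial[OF assms(1)] this]
    show ?thesis by simp
  qed
  show "(\<lambda>x. U x powr s) differentiable at x"
    using D differentiable_def by blast
  show "partial i (\<lambda>x. U x powr s) = (\<lambda>x. s * U x powr (s - 1) * partial i U x)"
    unfolding fun_eq_iff partial_eqI[OF D]
    using dir_deriv_axis[of i, unfolded fun_eq_iff dir_deriv_def] by simp
qed

text \<open>
  The derivative of \<open>U powr s\<close> is \<open>s * U powr (s - 1)\<close> times a derivative of \<open>U\<close>, a product of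
  the order \<open>(s - 1) / \<delta> + 1 / \<delta> - 1\<close> that the class requires. The induction over \<open>n\<close> therefore
  has to be carried out for all exponents \<open>s\<close> at once. For \<open>s = \<delta>\<close> the lemma speaks of the
  weight itself, which has order one and hence bounded first derivatives.
\<close>

lemma symbol_powr:
  assumes "symbol (\<lambda>x. U x powr \<delta>) c n (1 / \<delta>) U" "\<And>x. U x > 0" "0 < \<delta>" "0 \<le> c"
  shows "\<exists>C\<ge>0. symbol (\<lambda>x. U x powr \<delta>) C n (s / \<delta>) (\<lambda>x. U x powr s)"
  using assms(1)
proof (induction n arbitrary: s)
  case 0
  have "symbol (\<lambda>x. U x powr \<delta>) 1 0 (s / \<delta>) (\<lambda>x. U x powr s)"
    using assms(3) by (simp add: powr_powr)
  then show ?case by (intro exI[of _ 1]) simp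
next
  case (Suc n)
  let ?G = "\<lambda>x. U x powr \<delta>"
  from Suc.prems have diff: "\<And>x. U differentiable at x" by simp
  from Suc.IH[OF symbol_Suc_imp[OF Suc.prems], of "s - 1"] obtain C where
    C: "C \<ge> 0" "symbol ?G C n ((s - 1) / \<delta>) (\<lambda>x. U x powr (s - 1))" by blast
  have part: "symbol ?G (2 ^ n * C * c * \<bar>s\<bar>) n (s / \<delta> - 1) (partial i (\<lambda>x. U x powr s))" for i
  proof -
    have "symbol ?G (2 ^ n * C * c) n ((s - 1) / \<delta> + (1 / \<delta> - 1)) (\<lambda>x. U x powr (s - 1) * partial i U x)"
      by (rule symbol_mult[OF C(2) _ C(1) assms(4)]) (use Suc.prems in simp)
    from symbol_lincomb[of "{()}" ?G _ _ _ "\<lambda>_. (\<lambda>x. U x powr (s - 1) * partial i U x)" "\<lambda>_. s", OF _ this]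
    show ?thesis
      unfolding partial_powr(1)[OF diff assms(2)]
      using assms(3) by (simp add: diff_divide_distrib mult.assoc)
  qed
  let ?C = "max 1 (2 ^ n * C * c * \<bar>s\<bar>)"
  have "\<bar>U x powr s\<bar> \<le> ?C * ?G x powr (s / \<delta>)" for x
    using assms(3) mult_right_mono[of 1 ?C "U x powr s"] by (simp add: powr_powr)
  then have "symbol ?G ?C (Suc n) (s / \<delta>) (\<lambda>x. U x powr s)"
    using symbol_mono_const[OF _ part, of ?C] partial_powr(2)[OF diff assms(2)] by simp
  then show ?case
    by (intro exI[of _ ?C]) simp
qed

lemma symbol_of_foldr_partial:
  assumes "C_diff n h"
    and "\<And>is x. length is \<le> n \<Longrightarrow> \<bar>foldr partial is h x\<bar> \<le> c * G x powr (r - real (length is))"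
  shows "symbol G c n r h"
  using assms
proof (induction n arbitrary: r h)
  case 0
  from 0(2)[of "[]"] show ?case by simp
next
  case (Suc n)
  have "symbol G c n (r - 1) (partial i h)" for i
  proof (rule Suc.IH)
    fix "is" :: "'a list" and x assume "length is \<le> n"
    with Suc.prems(2)[of "is @ [i]" x] 
    show "\<bar>foldr partial is (partial i h) x\<bar> \<le> c * G x powr (r - 1 - real (length is))"
      by (simp add: algebra_simps)
  qed (use Suc.prems in simp)
  with Suc.prems(1) Suc.prems(2)[of "[]"] show ?case by simp
qed

text \<open>
  The weight is chosen so that the class condition \<open>1 - n * \<delta>\<close> on the exponent of \<open>1 + V\<close> becomes
  the loss of one order per derivative. At order zero the bound is \<open>V \<le> 1 + V = G powr (1 / \<delta>)\<close>.
\<close>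

lemma lyapunov_symbol:
  fixes V :: "real^'d::finite \<Rightarrow> real"
  assumes "V \<in> lyapunov_class p \<delta>" "0 < \<delta>" "p > 0"
  shows "\<exists>c\<ge>0. symbol (\<lambda>x. (1 + V x) powr \<delta>) c p (1 / \<delta>) (\<lambda>x. 1 + V x)"
proof -
  let ?G = "\<lambda>x. (1 + V x) powr \<delta>"
  from assms(1) obtain c where V: "C_diff p V" "\<And>x. 0 \<le> V x" and c: "c > 0"
    "\<And>n x. n \<in> {1..p} \<Longrightarrow> deriv_norm n V x \<le> c * (1 + V x) powr (1 - real n * \<delta>)"
    unfolding lyapunov_class_def by blast
  have G: "?G x powr (1 / \<delta> - real n) = (1 + V x) powr (1 - real n * \<delta>)" for x n
    using assms(2) by (simp add: powr_powr algebra_simps)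
  have "\<bar>foldr partial is V x\<bar> \<le> max 1 c * ?G x powr (1 / \<delta> - real (length is))"
    if "length is \<le> p" for "is" x
  proof (cases "is = []")
    case True
    have "V x \<le> 1 * (1 + V x)" by simp
    also have "\<dots> \<le> max 1 c * (1 + V x)"
      using V(2)[of x] by (intro mult_right_mono) auto
    finally show ?thesis
      using True V(2)[of x] G[of x 0] by simp
  next
    case False
    with that have "length is \<in> {1..p}" by (cases "is") auto
    note c(2)[OF this, of x]
    also have "c * (1 + V x) powr (1 - real (length is) * \<delta>) \<le>
        max 1 c * (1 + V x) powr (1 - real (length is) * \<delta>)"
      by (intro mult_right_mono) auto
    finally show ?thesis
      unfolding G using abs_foldr_partial_le_deriv_norm[OF C_diff_mono[OF V(1) that], of x] by simp
  qed
  with V(1) have S: "symbol ?G (max 1 c) p (1 / \<delta>) V"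
    by (rule symbol_of_foldr_partial)
  from assms(3) obtain q where p: "p = Suc q" by (cases p) auto
  from S have diff: "\<And>x. V differentiable at x" unfolding p by simp
  have "((\<lambda>x. 1 + V x) has_derivative (\<lambda>v. \<Sum>i\<in>UNIV. v $ i * partial i V x)) (at x)" for x
    using has_derivative_add[OF has_derivative_const has_derivative_sum_partial[OF diff]] by simp
  note D = this
  have part: "partial i (\<lambda>x. 1 + V x) = partial i V" for i
    unfolding fun_eq_iff partial_eqI[OF D]
    using dir_deriv_axis[of i, unfolded fun_eq_iff dir_deriv_def] by simp
  have bound: "\<bar>1 + V x\<bar> \<le> max 1 c * ?G x powr (1 / \<delta>)" for x
    using V(2)[of x] G[of x 0] mult_right_mono[of 1 "max 1 c" "1 + V x"] by simp
  have "\<And>x. (\<lambda>x. 1 + V x) differentiable at x"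
    using D differentiable_def by blast
  with S bound have "symbol ?G (max 1 c) p (1 / \<delta>) (\<lambda>x. 1 + V x)"
    unfolding p by (simp add: part)
  then show ?thesis
    by (intro exI[of _ "max 1 c"]) simp
qed

section \<open>Taylor expansion over a symmetric step\<close>

text \<open>
  The step \<open>s\<close> is kept as a parameter so that the values \<open>1\<close> and \<open>- 1\<close> produce the same
  coefficients, up to the signs that cancel in the symmetrisation.
\<close>

lemma symbol_taylor:
  assumes "symbol G c n r h"
  shows "\<exists>t. \<bar>t\<bar> \<le> \<bar>s\<bar> \<and> h (p + s *\<^sub>R v) =
    (\<Sum>m<n. (dir_deriv v ^^ m) h p / fact m * s ^ m) + (dir_deriv v ^^ n) h (p + t *\<^sub>R v) / fact n * s ^ n"
proof -
  let ?D = "\<lambda>m t. (dir_deriv v ^^ m) h (p + t *\<^sub>R v)"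
  have "DERIV (?D m) t :> ?D (Suc m) t" if "m < n" for m t
  proof -
    from that have "n = m + Suc (n - m - 1)" by simp
    with symbol_dir_deriv_funpow[of G c m "Suc (n - m - 1)" r h v] assms
    have "\<And>x. (dir_deriv v ^^ m) h differentiable at x" by simp
    from DERIV_along_line[OF this] show ?thesis by simp
  qed
  then have "\<exists>t. \<bar>t\<bar> \<le> \<bar>s\<bar> \<and> h (p + s *\<^sub>R v) =
      (\<Sum>m<n. ?D m 0 / fact m * s ^ m) + ?D n t / fact n * s ^ n"
    by (intro Maclaurin_bi_le) simp_all
  then show ?thesis by simp
qed

lemma sum_abs_le_card_norm:
  fixes v :: "real^'d::finite"
  shows "(\<Sum>i\<in>UNIV. \<bar>v $ i\<bar>) \<le> real CARD('d) * norm v"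
  using sum_bounded_above[of UNIV "\<lambda>i. \<bar>v $ i\<bar>" "norm v", OF component_le_norm_cart] by simp

lemma powr_comparable:
  fixes g :: real
  assumes "0 < g" "g / 2 \<le> g'" "g' \<le> 2 * g"
  shows "g' powr s \<le> 2 powr \<bar>s\<bar> * g powr s"
proof (cases "s \<ge> 0")
  case True
  then have "g' powr s \<le> (2 * g) powr s"
    using assms by (intro powr_mono2) auto
  with True assms show ?thesis by (simp add: powr_mult)
next
  case False
  then have "g' powr s \<le> (g / 2) powr s"
    using assms by (intro powr_mono2') auto
  with False assms show ?thesis by (simp add: powr_divide powr_minus divide_simps)
qed

lemma symbol_dir_deriv_bound:
  fixes v :: "real^'d::finite"
  assumes "symbol G c (m + n) r h" "0 \<le> c"
  shows "\<bar>(dir_deriv v ^^ m) h x\<bar> \<le> c * (real CARD('d) * norm v) ^ m * G x powr (r - real m)"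
proof -
  have "\<bar>(dir_deriv v ^^ m) h x\<bar> \<le> c * (\<Sum>i\<in>UNIV. \<bar>v $ i\<bar>) ^ m * G x powr (r - real m)"
    by (rule symbol_bound[OF symbol_dir_deriv_funpow[OF assms(1)]])
  also have "\<dots> \<le> c * (real CARD('d) * norm v) ^ m * G x powr (r - real m)"
    by (intro mult_right_mono mult_left_mono power_mono sum_abs_le_card_norm sum_nonneg) (use assms in auto)
  finally show ?thesis .
qed

lemma symbol_lipschitz:
  fixes v :: "real^'d::finite"
  assumes "symbol G c 1 1 G" "0 \<le> c" "\<And>x. 0 < G x"
  shows "\<bar>G (y + v) - G y\<bar> \<le> c * real CARD('d) * norm v"
proof -
  from symbol_taylor[OF assms(1), of 1 y v] obtain t where
    t: "G (y + v) - G y = (dir_deriv v ^^ 1) G (y + t *\<^sub>R v)" by auto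
  have "\<bar>(dir_deriv v ^^ 1) G (y + t *\<^sub>R v)\<bar> \<le>
      c * (real CARD('d) * norm v) ^ 1 * G (y + t *\<^sub>R v) powr (1 - real 1)"
    by (rule symbol_dir_deriv_bound[where n=0]) (use assms in auto)
  with t assms(3)[of "y + t *\<^sub>R v"] show ?thesis by (simp add: mult.assoc)
qed

text \<open>
  The three error terms are the fourth-order remainder along \<open>b\<close>, the second-order remainder along
  \<open>a\<close>, and the change of the second derivative along \<open>b\<close> when its base point moves from \<open>y + a\<close>
  to \<open>y\<close>. Counting \<open>a\<close> as \<open>e\<^sup>2 G\<close> and \<open>b\<close> as \<open>e G\<close>, each is of order \<open>e ^ 4\<close>, and the powers
  of \<open>G\<close> cancel because a derivative of order \<open>n\<close> carries the factor \<open>G ^ (- n)\<close>.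
\<close>

lemma symbol_symmetric_step_small:
  fixes G W :: "real^'d::finite \<Rightarrow> real"
  defines "\<kappa> \<equiv> real CARD('d)"
  assumes W: "symbol G c 4 \<alpha> W" "0 \<le> c" and WG: "\<And>x. W x = G x powr \<alpha>" and G: "\<And>x. 0 < G x"
    and near: "\<And>v. norm v \<le> norm a + norm b \<Longrightarrow> G y / 2 \<le> G (y + v) \<and> G (y + v) \<le> 2 * G y"
    and e: "0 \<le> e" "norm a \<le> e\<^sup>2 * G y" "norm b \<le> e * G y"
  shows "(W (y + a + b) + W (y + a - b)) / 2 \<le> W y + dir_deriv a W y + dir_deriv b (dir_deriv b W) y / 2
    + c * (\<kappa>^2 * 2 powr \<bar>\<alpha> - 2\<bar> + \<kappa>^3 * 2 powr \<bar>\<alpha> - 3\<bar> + \<kappa>^4 * 2 powr \<bar>\<alpha> - 4\<bar>) * W y * e ^ 4"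
proof -
  let ?g = "G y"
  have g: "?g > 0" by (rule G)
  have comp: "G (y + v) powr s \<le> 2 powr \<bar>s\<bar> * ?g powr s" if "norm v \<le> norm a + norm b" for v s
    using near[OF that] g by (intro powr_comparable) auto
  have \<kappa>: "\<kappa> \<ge> 0" by (simp add: \<kappa>_def)
  have powers: "?g ^ m * ?g powr (\<alpha> - real m) = W y" for m
    using g by (simp add: WG powr_realpow[symmetric] powr_add[symmetric])
  have D4: "\<bar>(dir_deriv b ^^ 4) W (y + a + t *\<^sub>R b)\<bar> \<le> c * \<kappa>^4 * 2 powr \<bar>\<alpha> - 4\<bar> * W y * e ^ 4"
    if "\<bar>t\<bar> \<le> 1" for t
  proof -
    have "norm (a + t *\<^sub>R b) \<le> norm a + norm b"
      using norm_triangle_ineq[of a "t *\<^sub>R b"] mult_right_mono[OF that norm_ge_zero[of b]] by simp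
    from comp[OF this, of "\<alpha> - 4"]
    have c1: "G (y + a + t *\<^sub>R b) powr (\<alpha> - 4) \<le> 2 powr \<bar>\<alpha> - 4\<bar> * ?g powr (\<alpha> - 4)"
      by (simp add: add.assoc)
    have "\<bar>(dir_deriv b ^^ 4) W (y + a + t *\<^sub>R b)\<bar> \<le>
        c * (\<kappa> * norm b) ^ 4 * G (y + a + t *\<^sub>R b) powr (\<alpha> - real 4)"
      unfolding \<kappa>_def by (rule symbol_dir_deriv_bound[where n=0]) (use W in auto)
    also have "\<dots> \<le> c * (\<kappa> * (e * ?g)) ^ 4 * (2 powr \<bar>\<alpha> - 4\<bar> * ?g powr (\<alpha> - 4))"
      using c1 \<kappa> e W(2) g by (intro mult_mono mult_left_mono power_mono) auto
    also have "\<dots> = c * \<kappa>^4 * 2 powr \<bar>\<alpha> - 4\<bar> * (?g ^ 4 * ?g powr (\<alpha> - real 4)) * e ^ 4"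
      by (simp add: power_mult_distrib mult_ac)
    finally show ?thesis unfolding powers .
  qed
  from symbol_taylor[OF W(1), of 1 "y + a" b] obtain t1 where t1: "\<bar>t1\<bar> \<le> 1"
    "W (y + a + b) = W (y + a) + dir_deriv b W (y + a) + dir_deriv b (dir_deriv b W) (y + a) / 2
      + (dir_deriv b ^^ 3) W (y + a) / fact 3 + (dir_deriv b ^^ 4) W (y + a + t1 *\<^sub>R b) / fact 4"
    by (auto simp: eval_nat_numeral)
  from symbol_taylor[OF W(1), of "-1" "y + a" b] obtain t2 where t2: "\<bar>t2\<bar> \<le> 1"
    "W (y + a - b) = W (y + a) - dir_deriv b W (y + a) + dir_deriv b (dir_deriv b W) (y + a) / 2
      - (dir_deriv b ^^ 3) W (y + a) / fact 3 + (dir_deriv b ^^ 4) W (y + a + t2 *\<^sub>R b) / fact 4"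
    by (auto simp: eval_nat_numeral)
  have "\<bar>(dir_deriv b ^^ 4) W (y + a + t *\<^sub>R b) / fact 4\<bar> \<le> c * \<kappa>^4 * 2 powr \<bar>\<alpha> - 4\<bar> * W y * e ^ 4"
    if "\<bar>t\<bar> \<le> 1" for t
    using D4[OF that] by (simp add: fact_numeral)
  note r = this
  \<comment> \<open>The first and third derivatives along \<open>b\<close> cancel in the mean.\<close>
  have "(x1 + x2) / 2 \<le> w + h / 2 + Q"
    if "\<bar>r1\<bar> \<le> Q" "\<bar>r2\<bar> \<le> Q" "x1 = w + d + h / 2 + z + r1" "x2 = w - d + h / 2 - z + r2"
    for x1 x2 w h Q r1 r2 d z :: real
    using abs_le_D1[OF that(1)] abs_le_D1[OF that(2)] unfolding that(3,4) by (simp add: field_simps)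
  from this[OF r[OF t1(1)] r[OF t2(1)] t1(2) t2(2)]
  have s1: "(W (y + a + b) + W (y + a - b)) / 2 \<le> W (y + a) + dir_deriv b (dir_deriv b W) (y + a) / 2
      + c * \<kappa>^4 * 2 powr \<bar>\<alpha> - 4\<bar> * W y * e ^ 4" .
  have ta: "norm (t *\<^sub>R a) \<le> norm a + norm b" if "\<bar>t\<bar> \<le> 1" for t
    using mult_right_mono[OF that norm_ge_zero[of a]] by (auto intro: add_increasing2)
  from symbol_taylor[OF symbol_mono_order[OF W(1), of 2], of 1 y a] obtain t3 where t3: "\<bar>t3\<bar> \<le> 1"
    "W (y + a) = W y + dir_deriv a W y + (dir_deriv a ^^ 2) W (y + t3 *\<^sub>R a) / 2"
    by (auto simp: eval_nat_numeral)
  have "\<bar>(dir_deriv a ^^ 2) W (y + t3 *\<^sub>R a)\<bar> \<le> c * (\<kappa> * norm a) ^ 2 * G (y + t3 *\<^sub>R a) powr (\<alpha> - real 2)"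
    unfolding \<kappa>_def by (rule symbol_dir_deriv_bound[where n=2]) (use W in auto)
  also have "\<dots> \<le> c * (\<kappa> * (e\<^sup>2 * ?g)) ^ 2 * (2 powr \<bar>\<alpha> - 2\<bar> * ?g powr (\<alpha> - real 2))"
    using comp[OF ta[OF t3(1)], of "\<alpha> - 2"] \<kappa> e W(2) g by (intro mult_mono mult_left_mono power_mono) auto
  also have "\<dots> = c * \<kappa>^2 * 2 powr \<bar>\<alpha> - 2\<bar> * (?g ^ 2 * ?g powr (\<alpha> - real 2)) * e ^ 4"
    by (simp add: power_mult_distrib mult_ac)
  finally have s2: "W (y + a) \<le> W y + dir_deriv a W y + c * \<kappa>^2 * 2 powr \<bar>\<alpha> - 2\<bar> * W y * e ^ 4"
    using t3(2) unfolding powers by linarith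
  have S2: "symbol G (c * (\<Sum>i\<in>UNIV. \<bar>b $ i\<bar>) ^ 2) 2 (\<alpha> - real 2) ((dir_deriv b ^^ 2) W)"
    by (rule symbol_dir_deriv_funpow) (use W(1) in simp)
  let ?H = "dir_deriv b (dir_deriv b W)"
  have le: "c * (\<Sum>i\<in>UNIV. \<bar>b $ i\<bar>) ^ 2 \<le> c * (\<kappa> * norm b) ^ 2"
    using sum_abs_le_card_norm[of b] W(2) by (intro mult_left_mono power_mono sum_nonneg) (auto simp: \<kappa>_def)
  have H: "(dir_deriv b ^^ 2) W = ?H" "\<alpha> - real 2 = \<alpha> - 2"
    by (simp_all add: numeral_2_eq_2)
  have S2': "symbol G (c * (\<kappa> * norm b) ^ 2) 2 (\<alpha> - 2) ?H"
    using symbol_mono_const[OF le S2] unfolding H .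
  then have S2'': "symbol G (c * (real CARD('d) * norm b) ^ 2) (1 + 1) (\<alpha> - 2) ?H"
    by (simp only: one_add_one \<kappa>_def)
  from symbol_taylor[OF symbol_mono_order[OF S2', of 1], of 1 y a] obtain t4 where t4: "\<bar>t4\<bar> \<le> 1"
    "?H (y + a) = ?H y + (dir_deriv a ^^ 1) ?H (y + t4 *\<^sub>R a)"
    by auto
  have "\<bar>(dir_deriv a ^^ 1) ?H (y + t4 *\<^sub>R a)\<bar> \<le>
      c * (\<kappa> * norm b) ^ 2 * (\<kappa> * norm a) ^ 1 * G (y + t4 *\<^sub>R a) powr (\<alpha> - 2 - real 1)"
    unfolding \<kappa>_def
    by (rule symbol_dir_deriv_bound[OF S2'']) (use W(2) in simp)
  also have "\<dots> = c * (\<kappa> * norm b) ^ 2 * (\<kappa> * norm a) * G (y + t4 *\<^sub>R a) powr (\<alpha> - 3)"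
    by (simp add: algebra_simps)
  also have "\<dots> \<le> c * (\<kappa> * (e * ?g)) ^ 2 * (\<kappa> * (e\<^sup>2 * ?g)) * (2 powr \<bar>\<alpha> - 3\<bar> * ?g powr (\<alpha> - 3))"
    using comp[OF ta[OF t4(1)], of "\<alpha> - 3"] \<kappa> e W(2) g
    by (intro mult_mono mult_left_mono power_mono) auto
  also have "\<dots> = c * \<kappa>^3 * 2 powr \<bar>\<alpha> - 3\<bar> * (?g ^ 3 * ?g powr (\<alpha> - real 3)) * e ^ 4"
    by (simp add: power_mult_distrib mult_ac eval_nat_numeral)
  finally have r3: "\<bar>?H (y + a) - ?H y\<bar> \<le> c * \<kappa>^3 * 2 powr \<bar>\<alpha> - 3\<bar> * W y * e ^ 4"
    using t4(2) unfolding powers by simp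
  have "\<dots> \<ge> 0"
    by (rule order_trans[OF abs_ge_zero r3])
  with r3 have s3: "?H (y + a) / 2 \<le> ?H y / 2 + c * \<kappa>^3 * 2 powr \<bar>\<alpha> - 3\<bar> * W y * e ^ 4"
    by linarith
  from s1 s2 s3 show ?thesis
    by (simp add: algebra_simps)
qed

text \<open>
  For \<open>e\<close> below the threshold \<open>e0\<close> the Lipschitz bound keeps \<open>G\<close> within a factor 2 over the step.
  Above it, both sides are at most \<open>W y\<close> times a polynomial in \<open>e\<close>, and \<open>e0 ^ 4 \<le> e ^ 4\<close> supplies
  the missing fourth power. The factor \<open>(1 + e) ^ q\<close> absorbs that polynomial; it does no harm since
  \<open>e\<close> will be affine in the length of a Gaussian vector, all of whose moments are finite.
\<close>

lemma symbol_symmetric_step: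
  fixes G W :: "real^'d::finite \<Rightarrow> real"
  assumes W: "symbol G c 4 \<alpha> W" "0 \<le> c" and WG: "\<And>x. W x = G x powr \<alpha>" and G: "\<And>x. 0 < G x"
    and GG: "symbol G c' 1 1 G" "0 \<le> c'" and \<alpha>: "0 \<le> \<alpha>"
  shows "\<exists>C\<ge>0. \<exists>q::nat. \<forall>y a b e. 0 \<le> e \<longrightarrow> norm a \<le> e\<^sup>2 * G y \<longrightarrow> norm b \<le> e * G y \<longrightarrow>
    (W (y + a + b) + W (y + a - b)) / 2
      \<le> W y + dir_deriv a W y + dir_deriv b (dir_deriv b W) y / 2 + C * W y * e ^ 4 * (1 + e) ^ q"
proof -
  define \<kappa> where "\<kappa> = real CARD('d)"
  have \<kappa>: "\<kappa> \<ge> 0" by (simp add: \<kappa>_def)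
  define L where "L = c' * \<kappa> + 1"
  have L: "L \<ge> 1" using GG(2) by (simp add: L_def \<kappa>_def)
  have lip: "\<bar>G (y + v) - G y\<bar> \<le> L * norm v" for y v
  proof -
    have "\<bar>G (y + v) - G y\<bar> \<le> c' * \<kappa> * norm v"
      unfolding \<kappa>_def by (rule symbol_lipschitz[OF GG G])
    also have "\<dots> \<le> L * norm v" by (simp add: L_def mult_right_mono)
    finally show ?thesis .
  qed
  define k where "k = nat \<lceil>\<alpha>\<rceil>"
  \<comment> \<open>With this threshold, \<open>L * (e\<^sup>2 + e) \<le> 1 / 2\<close> for all \<open>e \<le> e0\<close>: the step changes \<open>G\<close> by at most half its value.\<close>
  define e0 where "e0 = 1 / (4 * L)"
  have e0: "0 < e0" "e0 \<le> 1 / 4" "L * e0 = 1 / 4" using L by (auto simp: e0_def field_simps)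
  define C1 where "C1 = c * (\<kappa>^2 * 2 powr \<bar>\<alpha> - 2\<bar> + \<kappa>^3 * 2 powr \<bar>\<alpha> - 3\<bar> + \<kappa>^4 * 2 powr \<bar>\<alpha> - 4\<bar>)"
  define C2 where "C2 = ((1 + L) ^ k + c * \<kappa> + c * \<kappa>\<^sup>2) / e0 ^ 4"
  have C1: "C1 \<ge> 0" unfolding C1_def using W(2) \<kappa> by simp
  have C2: "C2 \<ge> 0" unfolding C2_def using W(2) \<kappa> L e0 by simp
  have W0: "W x > 0" for x using G[of x] by (simp add: WG)
  show ?thesis
  proof (intro exI[of _ "C1 + C2"] exI[of _ "2 * k + 2"] conjI allI impI)
    fix y a b :: "real^'d" and e :: real
    assume e: "0 \<le> e" "norm a \<le> e\<^sup>2 * G y" "norm b \<le> e * G y"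
    let ?lhs = "(W (y + a + b) + W (y + a - b)) / 2"
    let ?T = "W y + dir_deriv a W y + dir_deriv b (dir_deriv b W) y / 2"
    have e1: "(1 + e) ^ (2 * k + 2) \<ge> 1" using e(1) by (intro one_le_power) simp
    have nab: "norm a + norm b \<le> (e\<^sup>2 + e) * G y" using e by (simp add: algebra_simps)
    show "?lhs \<le> ?T + (C1 + C2) * W y * e ^ 4 * (1 + e) ^ (2 * k + 2)"
    proof (cases "e \<le> e0")
      case True
      have "e\<^sup>2 \<le> e" using True e0 e mult_left_le_one_le[of e e] by (simp add: power2_eq_square)
      then have "L * (e\<^sup>2 + e) \<le> L * (2 * e0)" using True L by (intro mult_left_mono) auto
      then have Le: "L * (e\<^sup>2 + e) \<le> 1 / 2" using e0 by simp
      have near: "G y / 2 \<le> G (y + v) \<and> G (y + v) \<le> 2 * G y" if "norm v \<le> norm a + norm b" for v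
      proof -
        have "L * norm v \<le> L * ((e\<^sup>2 + e) * G y)" using that nab L by (intro mult_left_mono) auto
        also have "\<dots> \<le> 1 / 2 * G y" using mult_right_mono[OF Le, of "G y"] G[of y] by (simp add: mult.assoc)
        finally show ?thesis using lip[of y v] G[of y] by (auto simp: abs_le_iff)
      qed
      have "?lhs \<le> ?T + C1 * W y * e ^ 4"
        unfolding C1_def \<kappa>_def by (rule symbol_symmetric_step_small[OF W WG G near e])
      also have "C1 * W y * e ^ 4 \<le> (C1 + C2) * W y * e ^ 4"
        using C2 W0[of y] e by (intro mult_right_mono) auto
      also have "\<dots> \<le> (C1 + C2) * W y * e ^ 4 * (1 + e) ^ (2 * k + 2)"
        using mult_left_mono[OF e1, of "(C1 + C2) * W y * e ^ 4"] C1 C2 W0[of y] e by simp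
      finally show ?thesis by simp
    next
      case False
      let ?E = "(1 + e) ^ (2 * k + 2)"
      have growth: "W (y + v) \<le> W y * ((1 + L) ^ k * ?E)" if "norm v \<le> norm a + norm b" for v
      proof -
        let ?r = "(1 + L) * (1 + e)\<^sup>2"
        have "G (y + v) \<le> G y + L * norm v" using lip[of y v] by linarith
        also have "\<dots> \<le> G y + L * ((e\<^sup>2 + e) * G y)" using that nab L by (intro add_left_mono mult_left_mono) auto
        also have "\<dots> = (1 + L * (e\<^sup>2 + e)) * G y" by (simp add: algebra_simps)
        also have "\<dots> \<le> ?r * G y"
          using G[of y] e L by (intro mult_right_mono) (auto simp: power2_eq_square algebra_simps)
        finally have "W (y + v) \<le> (?r * G y) powr \<alpha>"
          unfolding WG using G[of "y + v"] \<alpha> by (intro powr_mono2) auto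
        also have "\<dots> = ?r powr \<alpha> * W y"
          using G[of y] e L by (simp add: WG powr_mult)
        also have "?r \<ge> 1" using L e mult_mono[of 1 "1 + L" 1 "(1 + e)\<^sup>2"] by simp
        then have "?r powr \<alpha> \<le> ?r powr real k"
          using \<alpha> by (intro powr_mono) (auto simp: k_def)
        also have "?r powr real k = ?r ^ k"
          using \<open>?r \<ge> 1\<close> by (intro powr_realpow) auto
        also have "\<dots> \<le> (1 + L) ^ k * ?E"
          unfolding power_mult_distrib power_mult[symmetric]
          using e L by (intro mult_left_mono power_increasing) auto
        finally show ?thesis using W0[of y] by (simp add: mult_ac mult_left_mono)
      qed
      have "norm (a + b) \<le> norm a + norm b" "norm (a - b) \<le> norm a + norm b"
        by (rule norm_triangle_ineq norm_triangle_ineq4)+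
      from this[THEN growth] have lhs: "?lhs \<le> W y * ((1 + L) ^ k * ?E)"
        by (simp add: algebra_simps)
      have powers: "G y ^ m * G y powr (\<alpha> - real m) = W y" for m
        using G[of y] by (simp add: WG powr_realpow[symmetric] powr_add[symmetric])
      have "(1 + e)\<^sup>2 \<le> ?E" using e by (intro power_increasing) auto
      moreover have "e\<^sup>2 \<le> (1 + e)\<^sup>2" using e by (intro power_mono) auto
      ultimately have e2: "e\<^sup>2 \<le> ?E" by simp
      have "\<bar>(dir_deriv a ^^ 1) W y\<bar> \<le> c * (\<kappa> * norm a) ^ 1 * G y powr (\<alpha> - real 1)"
        unfolding \<kappa>_def by (rule symbol_dir_deriv_bound[where n=3]) (use W in auto)
      also have "\<dots> \<le> c * (\<kappa> * (e\<^sup>2 * G y)) ^ 1 * G y powr (\<alpha> - real 1)"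
        using e \<kappa> W(2) by (intro mult_right_mono mult_left_mono power_mono) auto
      also have "\<dots> = e\<^sup>2 * (c * \<kappa> * (G y ^ 1 * G y powr (\<alpha> - real 1)))" by simp
      also have "\<dots> \<le> ?E * (c * \<kappa> * W y)"
        unfolding powers using e2 W(2) \<kappa> W0[of y] by (intro mult_right_mono) auto
      finally have d1: "- dir_deriv a W y \<le> ?E * (c * \<kappa> * W y)" by simp
      have "\<bar>(dir_deriv b ^^ 2) W y\<bar> \<le> c * (\<kappa> * norm b) ^ 2 * G y powr (\<alpha> - real 2)"
        unfolding \<kappa>_def by (rule symbol_dir_deriv_bound[where n=2]) (use W in auto)
      also have "\<dots> \<le> c * (\<kappa> * (e * G y)) ^ 2 * G y powr (\<alpha> - real 2)"
        using e \<kappa> W(2) by (intro mult_right_mono mult_left_mono power_mono) auto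
      also have "\<dots> = e\<^sup>2 * (c * \<kappa>\<^sup>2 * (G y ^ 2 * G y powr (\<alpha> - real 2)))" by (simp add: power_mult_distrib)
      also have "\<dots> \<le> ?E * (c * \<kappa>\<^sup>2 * W y)"
        unfolding powers using e2 W(2) \<kappa> W0[of y] by (intro mult_right_mono) auto
      finally have d2: "\<bar>dir_deriv b (dir_deriv b W) y\<bar> \<le> ?E * (c * \<kappa>\<^sup>2 * W y)" by (simp add: eval_nat_numeral)
      have "?lhs - ?T \<le> W y * ((1 + L) ^ k * ?E) + ?E * (c * \<kappa> * W y) + ?E * (c * \<kappa>\<^sup>2 * W y)"
        using lhs d1 d2 W0[of y] by linarith
      also have "\<dots> = (C2 * W y * ?E) * e0 ^ 4"
        using e0(1) by (simp add: C2_def field_simps)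
      also have "\<dots> \<le> (C2 * W y * ?E) * e ^ 4"
        using False e0(1) C2 W0[of y] e by (intro mult_left_mono power_mono) auto
      also have "\<dots> \<le> ((C1 + C2) * W y * ?E) * e ^ 4"
        using C1 W0[of y] e by (intro mult_right_mono) auto
      also have "\<dots> = (C1 + C2) * W y * e ^ 4 * ?E"
        by (simp only: mult_ac)
      finally show ?thesis by linarith
    qed
  qed (use C1 C2 in simp)
qed

section \<open>Isotropic Gaussian vectors\<close>

definition gauss :: "real \<Rightarrow> (real^'m::finite) measure" where
  "gauss s = density lborel (\<lambda>x. ennreal (\<Prod>i\<in>UNIV. normal_density 0 s (x $ i)))"

lemma sets_gauss [simp, measurable_cong]: "sets (gauss s) = sets borel"
  by (simp add: gauss_def)

lemma space_gauss [simp]: "space (gauss s) = UNIV"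
  by (simp add: gauss_def)

lemma prod_Basis_cart:
  fixes F :: "real^'m::finite \<Rightarrow> 'b::comm_monoid_mult"
  shows "(\<Prod>b\<in>Basis. F b) = (\<Prod>i\<in>UNIV. F (axis i 1))"
proof -
  have "(Basis :: (real^'m) set) = range (\<lambda>i. axis i 1)"
    by (auto simp: Basis_vec_def)
  moreover have "inj (\<lambda>i::'m. axis i (1::real))"
    by (auto simp: inj_on_def axis_eq_axis)
  ultimately show ?thesis
    using prod.reindex[of "\<lambda>i::'m. axis i (1::real)" UNIV F] by (simp add: o_def)
qed

lemma nn_integral_gauss_prod:
  fixes f :: "'m::finite \<Rightarrow> real \<Rightarrow> real"
  assumes [measurable]: "\<And>i. f i \<in> borel_measurable borel" and nn: "\<And>i t. 0 \<le> f i t"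
  shows "(\<integral>\<^sup>+x. ennreal (\<Prod>i\<in>UNIV. f i (x $ i)) \<partial>gauss s) =
    (\<Prod>i\<in>UNIV. \<integral>\<^sup>+t. ennreal (normal_density 0 s t * f i t) \<partial>lborel)"
proof -
  \<comment> \<open>Fubini is indexed by basis vectors; \<open>idx\<close> recovers the coordinate from the basis vector.\<close>
  define idx :: "real^'m \<Rightarrow> 'm" where "idx b = (THE i. b = axis i 1)" for b
  have idx: "idx (axis i 1) = i" for i
    unfolding idx_def by (rule the_equality) (auto simp: axis_eq_axis)
  let ?F = "\<lambda>b t. ennreal (normal_density 0 s t * f (idx b) t)"
  have "(\<integral>\<^sup>+x. ennreal (\<Prod>i\<in>UNIV. f i (x $ i)) \<partial>gauss s) =
     (\<integral>\<^sup>+x. ennreal (\<Prod>i\<in>UNIV. normal_density 0 s (x $ i)) * ennreal (\<Prod>i\<in>UNIV. f i (x $ i)) \<partial>lborel)"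
    unfolding gauss_def by (rule nn_integral_density) measurable
  also have "\<dots> = (\<integral>\<^sup>+x. (\<Prod>b\<in>Basis. ?F b (x \<bullet> b)) \<partial>lborel)"
    unfolding prod_Basis_cart
    by (intro nn_integral_cong)
       (simp add: idx inner_axis prod_ennreal nn prod_nonneg prod.distrib flip: ennreal_mult)
  also have "\<dots> = (\<Prod>b\<in>Basis. \<integral>\<^sup>+t. ?F b t \<partial>lborel)"
    by (rule nn_integral_lborel_prod) auto
  also have "\<dots> = (\<Prod>i\<in>UNIV. \<integral>\<^sup>+t. ennreal (normal_density 0 s t * f i t) \<partial>lborel)"
    unfolding prod_Basis_cart by (simp add: idx)
  finally show ?thesis .
qed

lemma nn_integral_normal_density: "s > 0 \<Longrightarrow> (\<integral>\<^sup>+t. ennreal (normal_density 0 s t) \<partial>lborel) = 1"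
  by (subst nn_integral_eq_integral) auto

lemma prob_space_gauss:
  assumes "s > 0"
  shows "prob_space (gauss s :: (real^'a::finite) measure)"
proof
  have "emeasure (gauss s :: (real^'a) measure) (space (gauss s)) =
      (\<integral>\<^sup>+x. ennreal (\<Prod>i\<in>(UNIV::'a set). 1) \<partial>(gauss s :: (real^'a) measure))"
    by simp
  also have "\<dots> = 1"
    by (subst nn_integral_gauss_prod) (simp_all add: nn_integral_normal_density assms)
  finally show "emeasure (gauss s :: (real^'a) measure) (space (gauss s)) = 1" .
qed

lemma nn_integral_gauss_even_moment:
  fixes i :: "'m::finite"
  assumes "s > 0"
  shows "(\<integral>\<^sup>+x. ennreal ((x $ i) ^ (2 * k)) \<partial>gauss s) = ennreal (fact (2 * k) / ((2 / s\<^sup>2) ^ k * fact k))"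
proof -
  let ?f = "\<lambda>j t::real. if j = i then t ^ (2 * k) else 1"
  have "(\<integral>\<^sup>+x. ennreal ((x $ i) ^ (2 * k)) \<partial>gauss s) = (\<integral>\<^sup>+x. ennreal (\<Prod>j\<in>UNIV. ?f j (x $ j)) \<partial>gauss s)"
    by (simp add: prod.delta)
  also have "\<dots> = (\<Prod>j\<in>UNIV. \<integral>\<^sup>+t. ennreal (normal_density 0 s t * ?f j t) \<partial>lborel)"
    by (rule nn_integral_gauss_prod) (auto simp: power_mult)
  also have "\<dots> = (\<Prod>j\<in>UNIV. if j = i then \<integral>\<^sup>+t. ennreal (normal_density 0 s t * t ^ (2 * k)) \<partial>lborel else 1)"
    by (intro prod.cong) (auto simp: nn_integral_normal_density assms)
  also have "\<dots> = (\<integral>\<^sup>+t. ennreal (normal_density 0 s t * t ^ (2 * k)) \<partial>lborel)"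
    by (simp add: prod.delta)
  also have "\<dots> = ennreal (fact (2 * k) / ((2 / s\<^sup>2) ^ k * fact k))"
    using normal_moment_even[OF assms, of 0 k]
    by (subst nn_integral_eq_integral) (auto simp: has_bochner_integral_iff power_mult)
  finally show ?thesis .
qed

text \<open>
  The density depends on the squares of the coordinates only. Changing all signs gives the symmetry
  used for removing odd orders; changing a single sign makes distinct coordinates uncorrelated.
\<close>

lemma distr_gauss_signs:
  fixes e :: "'m::finite \<Rightarrow> real"
  assumes "\<And>i. \<bar>e i\<bar> = 1"
  shows "distr (gauss s) borel (\<lambda>x. \<chi> i. e i * x $ i) = gauss s"
proof -
  let ?T = "\<lambda>x::real^'m. \<chi> i. e i * x $ i"
  let ?n = "\<lambda>x::real^'m. ennreal (\<Prod>i\<in>UNIV. normal_density 0 s (x $ i))"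
  have T [measurable]: "?T \<in> borel_measurable borel"
    by (intro borel_measurable_continuous_onI continuous_intros)
  \<comment> \<open>The affine change of variables is indexed by basis vectors; \<open>c\<close> recovers the sign from the basis vector.\<close>
  define c :: "real^'m \<Rightarrow> real" where "c b = (\<Sum>i\<in>UNIV. e i * b $ i)" for b
  have c: "c (axis i 1) = e i" for i
    by (simp add: c_def axis_def if_distrib cong: if_cong)
  have sgn: "e i * e i = 1" for i
    using assms[of i] by (metis abs_mult_self_eq mult_1)
  have c1: "\<bar>c b\<bar> = 1" if "b \<in> Basis" for b
    using that assms by (auto simp: Basis_vec_def c)
  then have cnz: "c b \<noteq> 0" if "b \<in> Basis" for b
    using that by fastforce
  have "(\<Sum>j\<in>Basis. (c j * (x \<bullet> j)) *\<^sub>R j) = ?T x" for x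
  proof -
    have "(Basis :: (real^'m) set) = range (\<lambda>i. axis i 1)"
      by (auto simp: Basis_vec_def)
    moreover have "inj (\<lambda>i::'m. axis i (1::real))"
      by (auto simp: inj_on_def axis_eq_axis)
    ultimately have "(\<Sum>j\<in>Basis. (c j * (x \<bullet> j)) *\<^sub>R j) = (\<Sum>i\<in>UNIV. (e i * x $ i) *\<^sub>R axis i 1)"
      using sum.reindex[of "\<lambda>i::'m. axis i (1::real)" UNIV "\<lambda>j. (c j * (x \<bullet> j)) *\<^sub>R j"]
      by (simp add: o_def c inner_axis)
    also have "\<dots> = ?T x"
      using basis_expansion[of "?T x"] by (simp add: scalar_mult_eq_scaleR)
    finally show ?thesis .
  qed
  with lborel_affine_euclidean[of c 0, OF cnz]
  have "lborel = density (distr lborel borel ?T) (\<lambda>_. ennreal (\<Prod>j\<in>Basis. \<bar>c j\<bar>))"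
    by simp
  also have "(\<Prod>j\<in>Basis. \<bar>c j\<bar>) = 1"
    using c1 by simp
  finally have inv: "distr lborel borel ?T = (lborel :: (real^'m) measure)"
    by (simp add: density_1)
  have nT: "?n (?T x) = ?n x" for x
  proof -
    have "normal_density 0 s (e i * t) = normal_density 0 s t" for i t
      using sgn[of i] by (simp add: normal_density_def power_mult_distrib power2_eq_square)
    then show ?thesis by simp
  qed
  have "density lborel ?n = density (distr lborel borel ?T) ?n"
    by (simp add: inv)
  also have "\<dots> = distr (density lborel (\<lambda>x. ?n (?T x))) borel ?T"
    by (rule density_distr) measurable
  finally show ?thesis
    unfolding nT gauss_def ..
qed

lemma nn_integral_gauss_uminus:
  fixes h :: "real^'m::finite \<Rightarrow> ennreal"
  assumes [measurable]: "h \<in> borel_measurable borel"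
  shows "(\<integral>\<^sup>+x. h (- x) \<partial>gauss s) = (\<integral>\<^sup>+x. h x \<partial>gauss s)"
proof -
  have eq: "(\<chi> i. - 1 * x $ i) = - x" for x :: "real^'m"
    by (simp add: vec_eq_iff)
  have "(\<integral>\<^sup>+x. h x \<partial>gauss s) = (\<integral>\<^sup>+x. h x \<partial>distr (gauss s) borel uminus)"
    using distr_gauss_signs[of "\<lambda>_::'m. - 1" s] unfolding eq by simp
  also have "\<dots> = (\<integral>\<^sup>+x. h (- x) \<partial>gauss s)"
    by (rule nn_integral_distr) measurable
  finally show ?thesis ..
qed

lemma
  fixes i j :: "'m::finite"
  assumes "s > 0"
  shows integrable_gauss_covariance: "integrable (gauss s) (\<lambda>x. x $ i * x $ j)"
    and integral_gauss_covariance: "(\<integral>x. x $ i * x $ j \<partial>gauss s) = (if i = j then s\<^sup>2 else 0)"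
proof -
  have m2: "(\<integral>\<^sup>+x. ennreal ((x $ i)\<^sup>2) \<partial>gauss s) = ennreal (s\<^sup>2)" for i :: 'm
    using nn_integral_gauss_even_moment[OF assms, of i 1] by (simp add: eval_nat_numeral)
  have [measurable]: "(\<lambda>x::real^'m. x $ i) \<in> borel_measurable borel" for i
    by (intro borel_measurable_continuous_onI continuous_intros)
  have I2: "integrable (gauss s) (\<lambda>x. (x $ i)\<^sup>2)" for i :: 'm
    by (rule integrableI_nonneg) (auto simp: m2)
  show int: "integrable (gauss s) (\<lambda>x. x $ i * x $ j)"
  proof (rule Bochner_Integration.integrable_bound)
    show "integrable (gauss s) (\<lambda>x. (x $ i)\<^sup>2 + (x $ j)\<^sup>2)"
      using I2 by (rule Bochner_Integration.integrable_add) (rule I2)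
    have "\<bar>a * b\<bar> \<le> a\<^sup>2 + b\<^sup>2" for a b :: real
      using sum_squares_bound[of "\<bar>a\<bar>" "\<bar>b\<bar>"] mult_nonneg_nonneg[OF abs_ge_zero[of a] abs_ge_zero[of b]]
      unfolding abs_mult power2_abs by linarith
    then show "AE x in gauss s. norm (x $ i * x $ j) \<le> norm ((x $ i)\<^sup>2 + (x $ j)\<^sup>2)"
      by (intro AE_I2) simp
  qed measurable
  show "(\<integral>x. x $ i * x $ j \<partial>gauss s) = (if i = j then s\<^sup>2 else 0)"
  proof (cases "i = j")
    case True
    have "(\<integral>x. (x $ i)\<^sup>2 \<partial>gauss s) = s\<^sup>2"
      by (subst integral_eq_nn_integral) (auto simp: m2)
    with True show ?thesis by (simp add: power2_eq_square)
  next
    case False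
    let ?e = "\<lambda>k::'m. if k = i then - 1 else 1 :: real"
    let ?T = "\<lambda>x::real^'m. \<chi> k. ?e k * x $ k"
    have [measurable]: "?T \<in> borel_measurable borel"
      by (intro borel_measurable_continuous_onI continuous_intros)
    have "(\<integral>x. x $ i * x $ j \<partial>gauss s) = (\<integral>x. x $ i * x $ j \<partial>distr (gauss s) borel ?T)"
      by (subst distr_gauss_signs) auto
    also have "\<dots> = (\<integral>x. ?T x $ i * ?T x $ j \<partial>gauss s)"
      by (rule integral_distr) measurable
    also have "\<dots> = - (\<integral>x. x $ i * x $ j \<partial>gauss s)"
      using False by simp
    finally show ?thesis using False by simp
  qed
qed

text \<open>
  The length is measured in units of the standard deviation \<open>s\<close>, which makes the bound uniform in
  the step size. The norm is at most the dimension times the largest coordinate in modulus, which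
  reduces the claim to even moments of single coordinates.
\<close>

lemma gauss_norm_moments_bounded:
  "\<exists>c\<ge>0. \<forall>s>0. (\<integral>\<^sup>+x. ennreal ((1 + norm x / s) ^ q) \<partial>(gauss s :: (real^'m::finite) measure)) \<le> ennreal c"
proof -
  define m where "m = real CARD('m)"
  define \<mu> where "\<mu> = (fact (2 * q) / (2 ^ q * fact q) :: real)"
  have m: "m \<ge> 1" unfolding m_def by (simp add: Suc_leI)
  let ?c = "(2 * m) ^ (2 * q) * (1 + m * \<mu>)"
  have \<mu>: "\<mu> \<ge> 0" by (simp add: \<mu>_def)
  have pt: "(1 + norm x / s) ^ q \<le> (2 * m) ^ (2 * q) * (1 + (\<Sum>i\<in>UNIV. (x $ i) ^ (2 * q) / s ^ (2 * q)))"
    if s: "s > 0" for s and x :: "real^'m"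
  proof -
    let ?R = "range (\<lambda>j. \<bar>x $ j\<bar>)"
    have "Max ?R \<in> ?R"
      by (rule Max_in) auto
    then obtain i where "Max ?R = \<bar>x $ i\<bar>"
      by blast
    then have i: "\<bar>x $ j\<bar> \<le> \<bar>x $ i\<bar>" for j
      using Max_ge[of ?R "\<bar>x $ j\<bar>"] by simp
    let ?t = "\<bar>x $ i\<bar> / s"
    have "norm x \<le> m * \<bar>x $ i\<bar>"
      using norm_le_l1_cart[of x] sum_bounded_above[of UNIV "\<lambda>j. \<bar>x $ j\<bar>", OF i] by (simp add: m_def)
    then have "norm x / s \<le> m * ?t"
      using s by (simp add: divide_right_mono)
    then have "1 + norm x / s \<le> m * (1 + ?t)"
      using m by (simp add: algebra_simps)
    also have "\<dots> \<le> m * (2 * max 1 ?t)"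
      using m by (intro mult_left_mono) auto
    finally have le: "1 + norm x / s \<le> 2 * m * max 1 ?t" by simp
    have "(1 + norm x / s) ^ q \<le> (1 + norm x / s) ^ (2 * q)"
      using s by (intro power_increasing) auto
    also have "\<dots> \<le> (2 * m * max 1 ?t) ^ (2 * q)"
      using s le by (intro power_mono) auto
    also have "\<dots> = (2 * m) ^ (2 * q) * max 1 ?t ^ (2 * q)"
      by (rule power_mult_distrib)
    also have "max 1 ?t ^ (2 * q) \<le> 1 + ?t ^ (2 * q)"
      using s by (auto simp: max_def)
    also have "?t ^ (2 * q) = (x $ i) ^ (2 * q) / s ^ (2 * q)"
      by (simp add: power_divide power_mult)
    also have "\<dots> \<le> (\<Sum>i\<in>UNIV. (x $ i) ^ (2 * q) / s ^ (2 * q))"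
      by (rule member_le_sum) (auto simp: power_mult)
    finally show ?thesis using m by (simp add: mult_left_mono)
  qed
  have [measurable]: "(\<lambda>x::real^'m. x $ i) \<in> borel_measurable borel" for i
    by (intro borel_measurable_continuous_onI continuous_intros)
  have "(\<integral>\<^sup>+x. ennreal ((1 + norm x / s) ^ q) \<partial>(gauss s :: (real^'m) measure)) \<le> ennreal ?c"
    if s: "s > 0" for s
  proof -
    interpret prob_space "gauss s :: (real^'m) measure" by (rule prob_space_gauss[OF s])
    have mom: "(\<integral>\<^sup>+x. ennreal ((x $ i) ^ (2 * q) / s ^ (2 * q)) \<partial>gauss s) = ennreal \<mu>" for i :: 'm
    proof -
      have "(\<integral>\<^sup>+x. ennreal ((x $ i) ^ (2 * q) / s ^ (2 * q)) \<partial>gauss s) =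
          (\<integral>\<^sup>+x. ennreal (1 / s ^ (2 * q)) * ennreal ((x $ i) ^ (2 * q)) \<partial>gauss s)"
        by (intro nn_integral_cong) (simp add: power_mult flip: ennreal_mult)
      also have "\<dots> = ennreal (1 / s ^ (2 * q)) * ennreal (fact (2 * q) / ((2 / s\<^sup>2) ^ q * fact q))"
        by (subst nn_integral_cmult) (simp_all add: nn_integral_gauss_even_moment[OF s])
      also have "\<dots> = ennreal \<mu>"
        using s by (simp add: \<mu>_def power_divide power_mult flip: ennreal_mult)
      finally show ?thesis .
    qed
    have "(\<integral>\<^sup>+x. ennreal ((1 + norm x / s) ^ q) \<partial>(gauss s :: (real^'m) measure)) \<le>
        (\<integral>\<^sup>+x. ennreal ((2 * m) ^ (2 * q)) * (1 + (\<Sum>i\<in>UNIV. ennreal ((x $ i) ^ (2 * q) / s ^ (2 * q))))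
          \<partial>(gauss s :: (real^'m) measure))"
    proof (rule nn_integral_mono)
      fix x :: "real^'m"
      have nn: "\<And>i. 0 \<le> (x $ i) ^ (2 * q) / s ^ (2 * q)" by (simp add: power_mult)
      show "ennreal ((1 + norm x / s) ^ q) \<le>
        ennreal ((2 * m) ^ (2 * q)) * (1 + (\<Sum>i\<in>UNIV. ennreal ((x $ i) ^ (2 * q) / s ^ (2 * q))))"
        using ennreal_leI[OF pt[OF s, of x]] m nn
        by (simp add: ennreal_mult ennreal_plus sum_nonneg flip: sum_ennreal)
    qed
    also have "\<dots> = ennreal ((2 * m) ^ (2 * q)) * (1 + (\<Sum>i\<in>(UNIV :: 'm set). ennreal \<mu>))"
      using emeasure_space_1
      by (simp add: nn_integral_cmult nn_integral_add nn_integral_sum mom del: sum_ennreal)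
    also have "\<dots> = ennreal ?c"
      using m \<mu> by (simp add: m_def ennreal_mult ennreal_plus flip: ennreal_of_nat_eq_real_of_nat)
    finally show ?thesis .
  qed
  moreover have "?c \<ge> 0" using m \<mu> by simp
  ultimately show ?thesis by blast
qed

section \<open>The expected growth in one Euler--Maruyama step\<close>

lemma dir_deriv_twice:
  assumes "\<And>i x. partial i W differentiable at x"
  shows "dir_deriv b (dir_deriv b W) y = (\<Sum>i\<in>UNIV. \<Sum>j\<in>UNIV. b $ i * b $ j * partial i (partial j W) y)"
proof -
  have "dir_deriv b W = (\<lambda>x. \<Sum>j\<in>UNIV. b $ j * partial j W x)"
    by (simp add: fun_eq_iff dir_deriv_def)
  then have "partial i (dir_deriv b W) y = (\<Sum>j\<in>UNIV. b $ j * partial i (partial j W) y)" for i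
    using partial_lincomb(1)[of UNIV "\<lambda>j. partial j W" i "\<lambda>j. b $ j"] assms by simp
  then show ?thesis
    by (simp add: dir_deriv_def[of b "dir_deriv b W"] sum_distrib_left mult_ac)
qed

lemma norm_matrix_vector_mult_le:
  fixes A :: "real^'m::finite^'d::finite"
  shows "norm (A *v x) \<le> norm A * norm x"
proof -
  have "norm (A *v x) = L2_set (\<lambda>i. norm ((A *v x) $ i)) UNIV"
    by (simp add: norm_vec_def)
  also have "\<dots> \<le> L2_set (\<lambda>i. norm (A $ i) * norm x) UNIV"
    by (rule L2_set_mono) (auto simp: matrix_vector_mul_component Cauchy_Schwarz_ineq2)
  also have "\<dots> = norm A * norm x"
    by (simp add: norm_vec_def[of A] L2_set_left_distrib)
  finally show ?thesis .
qed

lemma has_bochner_integral_gauss_bilinear: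
  fixes A :: "real^'m::finite^'d::finite"
  assumes "s > 0"
  shows "has_bochner_integral (gauss s) (\<lambda>x. (A *v x) $ i * (A *v x) $ j) (s\<^sup>2 * (\<Sum>k\<in>UNIV. A $ i $ k * A $ j $ k))"
proof -
  have eq: "(A *v x) $ i * (A *v x) $ j = (\<Sum>k\<in>UNIV. \<Sum>l\<in>UNIV. (A $ i $ k * A $ j $ l) * (x $ k * x $ l))" for x
    by (simp add: matrix_vector_mult_def sum_product mult_ac)
  have "has_bochner_integral (gauss s) (\<lambda>x. x $ k * x $ l) (if k = l then s\<^sup>2 else 0)" for k l :: 'm
    using integrable_gauss_covariance[OF assms, of k l] integral_gauss_covariance[OF assms, of k l]
    by (simp add: has_bochner_integral_iff)
  then have "has_bochner_integral (gauss s) (\<lambda>x. \<Sum>k\<in>UNIV. \<Sum>l\<in>UNIV. (A $ i $ k * A $ j $ l) * (x $ k * x $ l))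
      (\<Sum>k\<in>UNIV. \<Sum>l\<in>UNIV. (A $ i $ k * A $ j $ l) * (if k = l then s\<^sup>2 else 0))"
    by (intro has_bochner_integral_sum has_bochner_integral_mult_right)
  then show ?thesis
    unfolding eq by (simp add: sum_distrib_left mult_ac if_distrib cong: if_cong)
qed

lemma gauss_symmetrize:
  fixes A :: "real^'m::finite^'d::finite" and W :: "real^'d \<Rightarrow> real"
  assumes [measurable]: "W \<in> borel_measurable borel" and nn: "\<And>x. 0 \<le> W x"
  shows "(\<integral>\<^sup>+x. ennreal (W (p + A *v x)) \<partial>gauss s) =
    (\<integral>\<^sup>+x. ennreal ((W (p + A *v x) + W (p - A *v x)) / 2) \<partial>gauss s)"
proof -
  have [measurable]: "(\<lambda>x. A *v x) \<in> borel_measurable borel"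
    by (intro borel_measurable_continuous_onI linear_continuous_on matrix_vector_mul_bounded_linear)
  let ?I = "\<integral>\<^sup>+x. ennreal (W (p + A *v x)) \<partial>gauss s"
  have neg: "A *v (- x) = - (A *v x)" for x
    using matrix_vector_mult_diff_distrib[of A 0 x] by simp
  have half: "ennreal (1 / 2) + ennreal (1 / 2) = 1"
    using ennreal_plus[of "1 / 2" "1 / 2"] by simp
  have avg: "ennreal ((u + v) / 2) = ennreal (1 / 2) * (ennreal u + ennreal v)" if "0 \<le> u" "0 \<le> v" for u v
  proof -
    have "ennreal ((u + v) / 2) = ennreal (1 / 2 * (u + v))"
      by simp
    also have "\<dots> = ennreal (1 / 2) * ennreal (u + v)"
      by (rule ennreal_mult) (use that in auto)
    also have "ennreal (u + v) = ennreal u + ennreal v"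
      by (rule ennreal_plus) fact+
    finally show ?thesis .
  qed
  have J: "(\<integral>\<^sup>+x. ennreal (W (p - A *v x)) \<partial>gauss s) = ?I"
    using nn_integral_gauss_uminus[of "\<lambda>x. ennreal (W (p + A *v x))" s]
    by (simp add: neg)
  have "(\<integral>\<^sup>+x. ennreal ((W (p + A *v x) + W (p - A *v x)) / 2) \<partial>gauss s) =
      (\<integral>\<^sup>+x. ennreal (1 / 2) * (ennreal (W (p + A *v x)) + ennreal (W (p - A *v x))) \<partial>gauss s)"
    by (intro nn_integral_cong avg nn)
  also have "\<dots> = ennreal (1 / 2) * (?I + ?I)"
    by (simp add: nn_integral_cmult nn_integral_add J)
  also have "\<dots> = (ennreal (1 / 2) + ennreal (1 / 2)) * ?I"
    by (simp only: distrib_left distrib_right)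
  also have "\<dots> = ?I"
    unfolding half by simp
  finally show ?thesis ..
qed

text \<open>
  The pathwise estimate \<open>step\<close> is used with \<open>e = \<eta> * (1 + |x| / s)\<close>: at least \<open>\<eta>\<close>, so that it
  dominates the drift, and large enough for the noise. Its remainder then separates into a power
  of \<open>\<eta>\<close> and a moment of the normalised length, while the second derivative along the noise
  integrates to a trace against the covariance.
\<close>

lemma gauss_step:
  fixes A :: "real^'m::finite^'d::finite" and W G :: "real^'d \<Rightarrow> real"
  assumes step: "\<And>b e. 0 \<le> e \<Longrightarrow> norm a \<le> e\<^sup>2 * G y \<Longrightarrow> norm b \<le> e * G y \<Longrightarrow>
      (W (y + a + b) + W (y + a - b)) / 2
        \<le> W y + dir_deriv a W y + dir_deriv b (dir_deriv b W) y / 2 + C * W y * e ^ 4 * (1 + e) ^ q"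
    and W: "W \<in> borel_measurable borel" "\<And>x. 0 \<le> W x" "\<And>i x. partial i W differentiable at x"
    and C: "0 \<le> C" and s: "0 < s"
    and M: "(\<integral>\<^sup>+x. ennreal ((1 + norm x / s) ^ (4 + q)) \<partial>(gauss s :: (real^'m) measure)) \<le> ennreal M" "0 \<le> M"
    and \<eta>: "0 \<le> \<eta>" "norm a \<le> \<eta>\<^sup>2 * G y" "norm A * s \<le> \<eta> * G y" and G: "0 \<le> G y"
  shows "(\<integral>\<^sup>+x. ennreal (W (y + a + A *v x)) \<partial>gauss s) \<le> ennreal (W y + dir_deriv a W y +
      s\<^sup>2 / 2 * (\<Sum>i\<in>UNIV. \<Sum>j\<in>UNIV. (\<Sum>k\<in>UNIV. A $ i $ k * A $ j $ k) * partial i (partial j W) y)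
      + C * W y * \<eta> ^ 4 * (1 + \<eta>) ^ q * M)"
proof -
  interpret prob_space "gauss s :: (real^'m) measure" by (rule prob_space_gauss[OF s])
  let ?z = "\<lambda>x::real^'m. 1 + norm x / s"
  let ?c = "C * W y * \<eta> ^ 4 * (1 + \<eta>) ^ q"
  have c: "?c \<ge> 0" using C W(2) \<eta>(1) by simp
  let ?Q = "\<lambda>x. \<Sum>i\<in>UNIV. \<Sum>j\<in>UNIV. ((A *v x) $ i * (A *v x) $ j) * partial i (partial j W) y"
  let ?R = "\<lambda>x. W y + dir_deriv a W y + ?Q x / 2 + ?c * ?z x ^ (4 + q)"
  have pt: "(W (y + a + A *v x) + W (y + a - A *v x)) / 2 \<le> ?R x" for x
  proof -
    have z: "?z x \<ge> 1" using s by simp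
    let ?e = "\<eta> * ?z x"
    have "norm a \<le> \<eta>\<^sup>2 * 1 * G y" using \<eta> by simp
    also have "\<dots> \<le> \<eta>\<^sup>2 * (?z x)\<^sup>2 * G y"
      using z G by (intro mult_right_mono mult_left_mono) auto
    finally have na: "norm a \<le> ?e\<^sup>2 * G y" by (simp add: power_mult_distrib)
    have "norm (A *v x) \<le> norm A * norm x" by (rule norm_matrix_vector_mult_le)
    also have "\<dots> = (norm A * s) * (norm x / s)" using s by simp
    also have "\<dots> \<le> (\<eta> * G y) * ?z x"
      by (rule mult_mono) (use \<eta> s G in auto)
    finally have nb: "norm (A *v x) \<le> ?e * G y" by (simp add: mult_ac)
    have e0: "0 \<le> ?e" using z \<eta>(1) by simp
    have "1 + ?e \<le> (1 + \<eta>) * ?z x"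
      using z by (simp only: distrib_right mult_1 add_le_cancel_right)
    then have "?e ^ 4 * (1 + ?e) ^ q \<le> ?e ^ 4 * ((1 + \<eta>) * ?z x) ^ q"
      using e0 by (intro mult_left_mono power_mono) (auto intro: add_nonneg_nonneg)
    also have "\<dots> = \<eta> ^ 4 * (1 + \<eta>) ^ q * ?z x ^ (4 + q)"
      by (simp add: power_mult_distrib power_add mult_ac)
    finally have "C * W y * (?e ^ 4 * (1 + ?e) ^ q) \<le> C * W y * (\<eta> ^ 4 * (1 + \<eta>) ^ q * ?z x ^ (4 + q))"
      using C W(2) by (intro mult_left_mono) auto
    moreover note step[OF e0 na nb]
    ultimately show ?thesis
      unfolding dir_deriv_twice[OF W(3)] by (simp add: mult.assoc)
  qed
  have zm: "(\<lambda>x. ?z x ^ (4 + q)) \<in> borel_measurable (gauss s)"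
    by measurable
  have z0: "?z x ^ (4 + q) \<ge> 0" for x using s by simp
  have zi: "integrable (gauss s) (\<lambda>x. ?z x ^ (4 + q))"
    using M(1) z0 by (intro integrableI_nonneg[OF zm]) (auto simp: less_top top_unique intro: le_less_trans)
  have "(\<integral>x. ?z x ^ (4 + q) \<partial>gauss s) = enn2real (\<integral>\<^sup>+x. ennreal (?z x ^ (4 + q)) \<partial>gauss s)"
    using z0 by (intro integral_eq_nn_integral zm) auto
  also have "\<dots> \<le> M"
    using enn2real_mono[OF M(1)] M(2) by simp
  finally have zM: "(\<integral>x. ?z x ^ (4 + q) \<partial>gauss s) \<le> M" .
  let ?S = "\<Sum>i\<in>UNIV. \<Sum>j\<in>UNIV. (s\<^sup>2 * (\<Sum>k\<in>UNIV. A $ i $ k * A $ j $ k)) * partial i (partial j W) y"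
  have Q: "has_bochner_integral (gauss s) ?Q ?S"
    by (intro has_bochner_integral_sum has_bochner_integral_mult_left has_bochner_integral_gauss_bilinear[OF s])
  have Ri: "integrable (gauss s) ?R"
    using zi Q unfolding has_bochner_integral_iff by (intro Bochner_Integration.integrable_add) auto
  have R: "(\<integral>x. ?R x \<partial>gauss s) = W y + dir_deriv a W y + ?S / 2 + ?c * (\<integral>x. ?z x ^ (4 + q) \<partial>gauss s)"
    using zi Q prob_space by (simp add: has_bochner_integral_iff)
  have R0: "?R x \<ge> 0" for x
    by (rule order_trans[OF _ pt[of x]]) (simp add: W(2))
  have "(\<integral>\<^sup>+x. ennreal (W (y + a + A *v x)) \<partial>gauss s) \<le> (\<integral>\<^sup>+x. ennreal (?R x) \<partial>gauss s)"
    unfolding gauss_symmetrize[OF W(1,2)] by (intro nn_integral_mono ennreal_leI pt)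
  also have "\<dots> = ennreal (\<integral>x. ?R x \<partial>gauss s)"
    using R0 by (intro nn_integral_eq_integral Ri) auto
  also have "\<dots> \<le> ennreal (W y + dir_deriv a W y + ?S / 2 + ?c * M)"
    unfolding R using mult_left_mono[OF zM c] by (intro ennreal_leI) simp
  also have "?S / 2 = s\<^sup>2 / 2 * (\<Sum>i\<in>UNIV. \<Sum>j\<in>UNIV. (\<Sum>k\<in>UNIV. A $ i $ k * A $ j $ k) * partial i (partial j W) y)"
    by (simp add: sum_distrib_left sum_divide_distrib mult_ac)
  finally show ?thesis .
qed

text \<open>
  The chain rule shows that the left-hand side of the Lyapunov condition is the generator applied
  to the power of \<open>1 + V\<close>, written in the form in which the Taylor expansion produces it.
\<close>

lemma generator_powr:
  fixes V :: "real^'d::finite \<Rightarrow> real" and f :: "real^'d \<Rightarrow> real^'d" and g :: "real^'d \<Rightarrow> real^'m::finite^'d"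
    and \<rho> :: real
  assumes V: "\<And>x. 0 \<le> V x" "\<And>x. V differentiable at x" "\<And>i x. partial i V differentiable at x"
  defines "W \<equiv> \<lambda>x. (1 + V x) powr \<rho>"
  shows "dir_deriv (f x) W x +
      1 / 2 * (\<Sum>i\<in>UNIV. \<Sum>j\<in>UNIV. (\<Sum>k\<in>UNIV. g x $ i $ k * g x $ j $ k) * partial i (partial j W) x)
    = \<rho> / 2 * (1 + V x) powr (\<rho> - 2) *
        (2 * (1 + V x) * generator f g V x + (\<rho> - 1) * (norm (gradient V x v* g x))\<^sup>2)"
proof -
  let ?U = "\<lambda>x. 1 + V x"
  have U0: "?U x > 0" for x using V(1)[of x] by simp
  have DU: "(?U has_derivative (\<lambda>v. \<Sum>i\<in>UNIV. v $ i * partial i V x)) (at x)" for x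
    using has_derivative_add[OF has_derivative_const has_derivative_sum_partial[OF V(2)]] by simp
  have diffU: "?U differentiable at x" for x
    using DU differentiable_def by blast
  have pU: "partial i ?U = partial i V" for i
    unfolding fun_eq_iff partial_eqI[OF DU]
    using dir_deriv_axis[of i, unfolded fun_eq_iff dir_deriv_def] by simp
  have p1: "partial i W = (\<lambda>x. \<rho> * ?U x powr (\<rho> - 1) * partial i V x)" for i
    unfolding W_def using partial_powr(1)[OF diffU U0] by (simp add: pU)
  let ?u = "?U x powr (\<rho> - 2)"
  have u1: "?U x powr (\<rho> - 1) = ?u * ?U x"
    using U0[of x] powr_add[of "?U x" "\<rho> - 2" 1] by simp
  have p2: "partial i (partial j W) x =
      \<rho> * ?u * ((\<rho> - 1) * partial i V x * partial j V x + ?U x * partial i (partial j V) x)" for i j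
  proof -
    have d: "(\<lambda>x. ?U x powr (\<rho> - 1)) differentiable at x" for x
      by (rule partial_powr(2)[OF diffU U0])
    have "partial j W = (\<lambda>x. \<rho> * (?U x powr (\<rho> - 1) * partial j V x))"
      unfolding p1 by (simp add: mult.assoc)
    then have "partial i (partial j W) x = \<rho> * partial i (\<lambda>x. ?U x powr (\<rho> - 1) * partial j V x) x"
      using partial_lincomb(1)[of "{()}" "\<lambda>_ x. ?U x powr (\<rho> - 1) * partial j V x" i "\<lambda>_. \<rho>"]
      using differentiable_mult[OF d V(3)] by simp
    also have "\<dots> = \<rho> * (?U x powr (\<rho> - 1) * partial i (partial j V) x
        + (\<rho> - 1) * ?u * partial i V x * partial j V x)"
      unfolding partial_mult[OF d V(3)] partial_powr(1)[OF diffU U0] pU by simp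
    finally show ?thesis unfolding u1 by (simp add: algebra_simps)
  qed
  let ?a = "\<lambda>i k. g x $ i $ k"
  have quad: "(norm (gradient V x v* g x))\<^sup>2 =
      (\<Sum>i\<in>UNIV. \<Sum>j\<in>UNIV. (\<Sum>k\<in>UNIV. ?a i k * ?a j k) * (partial i V x * partial j V x))"
  proof -
    have "(norm (gradient V x v* g x))\<^sup>2 = (\<Sum>k\<in>UNIV. (\<Sum>i\<in>UNIV. partial i V x * ?a i k)\<^sup>2)"
      unfolding power2_norm_eq_inner inner_vec_def
      by (simp add: vector_matrix_mult_def gradient_def power2_eq_square mult_ac)
    also have "\<dots> = (\<Sum>k\<in>UNIV. \<Sum>i\<in>UNIV. \<Sum>j\<in>UNIV. (partial i V x * ?a i k) * (partial j V x * ?a j k))"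
      by (simp add: power2_eq_square sum_product)
    also have "\<dots> = (\<Sum>i\<in>UNIV. \<Sum>j\<in>UNIV. \<Sum>k\<in>UNIV. (partial i V x * ?a i k) * (partial j V x * ?a j k))"
      by (subst sum.swap, rule sum.cong[OF refl], rule sum.swap)
    also have "\<dots> = (\<Sum>i\<in>UNIV. \<Sum>j\<in>UNIV. (\<Sum>k\<in>UNIV. ?a i k * ?a j k) * (partial i V x * partial j V x))"
      by (simp add: sum_distrib_left sum_distrib_right mult_ac)
    finally show ?thesis .
  qed
  have tr: "trace (transpose (g x) ** hessian V x ** g x) =
      (\<Sum>i\<in>UNIV. \<Sum>j\<in>UNIV. (\<Sum>k\<in>UNIV. ?a i k * ?a j k) * partial i (partial j V) x)"
  proof -
    have "trace (transpose (g x) ** hessian V x ** g x) =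
        (\<Sum>k\<in>UNIV. \<Sum>j\<in>UNIV. (\<Sum>i\<in>UNIV. ?a i k * partial i (partial j V) x) * ?a j k)"
      by (simp add: trace_def matrix_matrix_mult_def transpose_def hessian_def)
    also have "\<dots> = (\<Sum>k\<in>UNIV. \<Sum>i\<in>UNIV. \<Sum>j\<in>UNIV. ?a i k * partial i (partial j V) x * ?a j k)"
      unfolding sum_distrib_right by (rule sum.cong[OF refl], rule sum.swap)
    also have "\<dots> = (\<Sum>i\<in>UNIV. \<Sum>j\<in>UNIV. \<Sum>k\<in>UNIV. ?a i k * partial i (partial j V) x * ?a j k)"
      by (subst sum.swap, rule sum.cong[OF refl], rule sum.swap)
    also have "\<dots> = (\<Sum>i\<in>UNIV. \<Sum>j\<in>UNIV. (\<Sum>k\<in>UNIV. ?a i k * ?a j k) * partial i (partial j V) x)"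
      by (simp add: sum_distrib_left sum_distrib_right mult_ac)
    finally show ?thesis .
  qed
  have grad: "dir_deriv (f x) W x = \<rho> * (?u * ?U x) * (gradient V x \<bullet> f x)"
    unfolding dir_deriv_def p1 u1 gradient_def inner_vec_def
    by (simp add: sum_distrib_left mult_ac)
  have "(\<Sum>i\<in>UNIV. \<Sum>j\<in>UNIV. (\<Sum>k\<in>UNIV. ?a i k * ?a j k) * partial i (partial j W) x) =
     (\<Sum>i\<in>UNIV. \<Sum>j\<in>UNIV. \<rho> * ?u * (\<rho> - 1) * ((\<Sum>k\<in>UNIV. ?a i k * ?a j k) * (partial i V x * partial j V x)) +
        \<rho> * ?u * ?U x * ((\<Sum>k\<in>UNIV. ?a i k * ?a j k) * partial i (partial j V) x))"
    unfolding p2 by (intro sum.cong refl) (simp only: algebra_simps)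
  also have "\<dots> = \<rho> * ?u * (\<rho> - 1) * (norm (gradient V x v* g x))\<^sup>2 +
     \<rho> * ?u * ?U x * trace (transpose (g x) ** hessian V x ** g x)"
    unfolding quad tr sum.distrib sum_distrib_left ..
  finally have hess: "(\<Sum>i\<in>UNIV. \<Sum>j\<in>UNIV. (\<Sum>k\<in>UNIV. ?a i k * ?a j k) * partial i (partial j W) x) =
     \<rho> * ?u * (\<rho> - 1) * (norm (gradient V x v* g x))\<^sup>2 +
     \<rho> * ?u * ?U x * trace (transpose (g x) ** hessian V x ** g x)" .
  have alg: "\<rho> * (u * z) * d + 1 / 2 * (\<rho> * u * (\<rho> - 1) * n + \<rho> * u * z * t) =
      \<rho> / 2 * u * (2 * z * (d + 1 / 2 * t) + (\<rho> - 1) * n)" for u z d n t :: real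
    by (simp add: field_simps)
  show ?thesis
    unfolding hess grad generator_def by (rule alg)
qed

text \<open>
  Here \<open>h\<close> stands for \<open>K * \<Delta> powr (- \<theta>)\<close>; the exponent \<open>\<theta> \<le> 1/2\<close> enters only through
  \<open>h\<^sup>2 \<Delta> \<le> K\<^sup>2\<close>. With \<open>\<eta> = sqrt (h \<Delta>)\<close> this bounds \<open>\<eta> ^ 4\<close> by \<open>K\<^sup>2 \<Delta>\<close>, which gives the
  remainder the factor \<open>\<Delta>\<close>, and \<open>\<eta>\<close> by \<open>sqrt K\<close>, which keeps its other factors bounded.
\<close>

lemma one_step_moment_bound:
  fixes V :: "real^'d::finite \<Rightarrow> real" and f :: "real^'d \<Rightarrow> real^'d" and g :: "real^'d \<Rightarrow> real^'m::finite^'d"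
    and \<delta> \<rho> lam K :: real
  assumes V: "V \<in> lyapunov_class 4 \<delta>" and pos: "0 < \<delta>" "0 < \<rho>" "0 < lam" "0 < K"
    and gen: "\<And>x. \<rho> / 2 * (1 + V x) powr (\<rho> - 2) *
              (2 * (1 + V x) * generator f g V x + (\<rho> - 1) * (norm (gradient V x v* g x))\<^sup>2)
            \<le> lam * (1 + V x powr \<rho>)"
  shows "\<exists>C\<ge>0. \<forall>\<Delta> h y. 0 < \<Delta> \<longrightarrow> \<Delta> \<le> 1 \<longrightarrow> 0 \<le> h \<longrightarrow> h\<^sup>2 * \<Delta> \<le> K\<^sup>2 \<longrightarrow>
      norm (f y) \<le> h * (1 + V y) powr \<delta> \<longrightarrow> (norm (g y))\<^sup>2 \<le> h * ((1 + V y) powr \<delta>)\<^sup>2 \<longrightarrow>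
      (\<integral>\<^sup>+z. ennreal ((1 + V (y + \<Delta> *\<^sub>R f y + g y *v z)) powr \<rho>) \<partial>gauss (sqrt \<Delta>))
        \<le> ennreal ((1 + C * \<Delta>) * (1 + V y) powr \<rho>)"
proof -
  let ?U = "\<lambda>x. 1 + V x"
  define G where "G = (\<lambda>x. ?U x powr \<delta>)"
  define W where "W = (\<lambda>x. ?U x powr \<rho>)"
  have V0: "0 \<le> V x" for x using V by (simp add: lyapunov_class_def)
  have U0: "0 < ?U x" for x using V0[of x] by simp
  have CV: "C_diff 4 V" using V by (simp add: lyapunov_class_def)
  then have diffV: "\<And>x. V differentiable at x" "\<And>i x. partial i V differentiable at x"
    by (simp_all add: eval_nat_numeral)
  obtain c where c: "0 \<le> c" "symbol G c 4 (1 / \<delta>) ?U"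
    unfolding G_def using lyapunov_symbol[OF V pos(1)] by auto
  obtain cW where cW: "0 \<le> cW" "symbol G cW 4 (\<rho> / \<delta>) W"
    unfolding G_def W_def using symbol_powr[OF c(2)[unfolded G_def] U0 pos(1) c(1)] by blast
  obtain cG where cG: "0 \<le> cG" "symbol G cG 4 (\<delta> / \<delta>) G"
    using symbol_powr[OF c(2)[unfolded G_def] U0 pos(1) c(1), of \<delta>] unfolding G_def by blast
  have cG1: "symbol G cG 1 1 G"
    using symbol_mono_order[OF cG(2), of 1] pos(1) by simp
  have WG: "W x = G x powr (\<rho> / \<delta>)" for x
    using pos(1) by (simp add: W_def G_def powr_powr)
  have G0: "0 < G x" for x using U0[of x] by (simp add: G_def)
  have W0: "0 < W x" for x using U0[of x] by (simp add: W_def)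
  have "0 \<le> \<rho> / \<delta>" using pos(1,2) by simp
  from symbol_symmetric_step[OF cW(2,1) WG G0 cG1 cG(1) this] obtain C0 q where C0: "0 \<le> C0"
    and "\<forall>y a b e. 0 \<le> e \<longrightarrow> norm a \<le> e\<^sup>2 * G y \<longrightarrow> norm b \<le> e * G y \<longrightarrow>
      (W (y + a + b) + W (y + a - b)) / 2
        \<le> W y + dir_deriv a W y + dir_deriv b (dir_deriv b W) y / 2 + C0 * W y * e ^ 4 * (1 + e) ^ q"
    by (elim exE conjE)
  note step = this(2)[rule_format]
  obtain M where M: "0 \<le> M"
    "\<And>s. 0 < s \<Longrightarrow> (\<integral>\<^sup>+x. ennreal ((1 + norm x / s) ^ (4 + q)) \<partial>(gauss s :: (real^'m) measure)) \<le> ennreal M"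
    using gauss_norm_moments_bounded[of "4 + q"] by blast
  have diffW: "W differentiable at x" "partial i W differentiable at x" for i x
    using cW(2) by (simp_all add: eval_nat_numeral)
  have Wm: "W \<in> borel_measurable borel"
    by (intro borel_measurable_continuous_onI continuous_at_imp_continuous_on ballI
        differentiable_imp_continuous_within diffW)
  define C where "C = 2 * lam + C0 * K\<^sup>2 * (1 + sqrt K) ^ q * M"
  have "C \<ge> 0" using pos C0 M(1) by (simp add: C_def)
  moreover have "(\<integral>\<^sup>+z. ennreal (W (y + \<Delta> *\<^sub>R f y + g y *v z)) \<partial>gauss (sqrt \<Delta>)) \<le> ennreal ((1 + C * \<Delta>) * W y)"
    if \<Delta>: "0 < \<Delta>" "\<Delta> \<le> 1" and h: "0 \<le> h" "h\<^sup>2 * \<Delta> \<le> K\<^sup>2"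
      and f: "norm (f y) \<le> h * G y" and g: "(norm (g y))\<^sup>2 \<le> h * (G y)\<^sup>2" for \<Delta> h y
  proof -
    define \<eta> where "\<eta> = sqrt (h * \<Delta>)"
    have \<eta>: "0 \<le> \<eta>" "\<eta>\<^sup>2 = h * \<Delta>" using \<Delta> h by (auto simp: \<eta>_def)
    have "(h * \<Delta>)\<^sup>2 = (h\<^sup>2 * \<Delta>) * \<Delta>" by (simp add: power2_eq_square)
    moreover have "(h\<^sup>2 * \<Delta>) * \<Delta> \<le> K\<^sup>2 * \<Delta>" using h \<Delta> by (intro mult_right_mono) auto
    ultimately have h\<Delta>: "(h * \<Delta>)\<^sup>2 \<le> K\<^sup>2 * \<Delta>" by simp
    have "\<eta> ^ 4 = (h * \<Delta>)\<^sup>2"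
      unfolding \<eta>(2)[symmetric] by simp
    with h\<Delta> have \<eta>4: "\<eta> ^ 4 \<le> K\<^sup>2 * \<Delta>" by simp
    have "K\<^sup>2 * \<Delta> \<le> K\<^sup>2"
      by (rule mult_left_le) (use \<Delta> in auto)
    with h\<Delta> have "(h * \<Delta>)\<^sup>2 \<le> K\<^sup>2" by (rule order_trans)
    then have "h * \<Delta> \<le> K"
      by (rule power2_le_imp_le) (use pos(4) in simp)
    then have \<eta>K: "\<eta> \<le> sqrt K" by (simp add: \<eta>_def)
    have "norm (\<Delta> *\<^sub>R f y) = \<Delta> * norm (f y)"
      using \<Delta>(1) by simp
    also have "\<dots> \<le> \<Delta> * (h * G y)"
      using f \<Delta>(1) by (intro mult_left_mono) auto
    finally have na: "norm (\<Delta> *\<^sub>R f y) \<le> \<eta>\<^sup>2 * G y"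
      unfolding \<eta>(2) by (simp only: mult_ac)
    have "(norm (g y) * sqrt \<Delta>)\<^sup>2 = (norm (g y))\<^sup>2 * \<Delta>"
      using \<Delta>(1) by (simp add: power_mult_distrib)
    also have "\<dots> \<le> h * (G y)\<^sup>2 * \<Delta>"
      using g \<Delta>(1) by (intro mult_right_mono) auto
    also have "\<dots> = (\<eta> * G y)\<^sup>2"
      unfolding power_mult_distrib \<eta>(2) by (simp only: mult_ac)
    finally have nb: "norm (g y) * sqrt \<Delta> \<le> \<eta> * G y"
      by (rule power2_le_imp_le) (use \<eta>(1) G0[of y] in simp)
    let ?H = "\<Sum>i\<in>UNIV. \<Sum>j\<in>UNIV. (\<Sum>k\<in>UNIV. g y $ i $ k * g y $ j $ k) * partial i (partial j W) y"
    have "(\<integral>\<^sup>+z. ennreal (W (y + \<Delta> *\<^sub>R f y + g y *v z)) \<partial>gauss (sqrt \<Delta>)) \<le>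
      ennreal (W y + dir_deriv (\<Delta> *\<^sub>R f y) W y + (sqrt \<Delta>)\<^sup>2 / 2 * ?H + C0 * W y * \<eta> ^ 4 * (1 + \<eta>) ^ q * M)"
      by (rule gauss_step[where A = "g y" and G = G, OF step Wm less_imp_le[OF W0] diffW(2) C0 _ M(2) M(1) \<eta>(1) na nb less_imp_le[OF G0]])
         (use \<Delta> in auto)
    also have "\<dots> \<le> ennreal ((1 + C * \<Delta>) * W y)"
    proof (rule ennreal_leI)
      have "dir_deriv (\<Delta> *\<^sub>R f y) W y = \<Delta> * dir_deriv (f y) W y"
        by (simp add: dir_deriv_def sum_distrib_left mult_ac)
      then have "dir_deriv (\<Delta> *\<^sub>R f y) W y + (sqrt \<Delta>)\<^sup>2 / 2 * ?H = \<Delta> * (dir_deriv (f y) W y + 1 / 2 * ?H)"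
        using \<Delta> by (simp add: algebra_simps)
      also have "dir_deriv (f y) W y + 1 / 2 * ?H \<le> lam * (1 + V y powr \<rho>)"
        using gen[of y] unfolding W_def generator_powr[OF V0 diffV] .
      also have "\<dots> \<le> lam * (W y + W y)"
      proof -
        have "1 \<le> W y" using ge_one_powr_ge_zero[of "?U y" \<rho>] V0[of y] pos by (simp add: W_def)
        moreover have "V y powr \<rho> \<le> W y"
          unfolding W_def using V0[of y] pos by (intro powr_mono2) auto
        ultimately show ?thesis using pos by (intro mult_left_mono add_mono) auto
      qed
      finally have drift: "dir_deriv (\<Delta> *\<^sub>R f y) W y + (sqrt \<Delta>)\<^sup>2 / 2 * ?H \<le> \<Delta> * (lam * (W y + W y))"
        using \<Delta> by (simp add: mult_left_mono)
      have "C0 * W y * \<eta> ^ 4 * (1 + \<eta>) ^ q * M \<le> C0 * W y * (K\<^sup>2 * \<Delta>) * (1 + sqrt K) ^ q * M"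
        using \<eta>4 \<eta>K \<eta>(1) C0 M(1) W0[of y] \<Delta> pos
        by (intro mult_right_mono mult_mono mult_left_mono power_mono) auto
      also have "\<dots> = \<Delta> * (C0 * K\<^sup>2 * (1 + sqrt K) ^ q * M) * W y"
        by (simp add: mult_ac)
      finally show "W y + dir_deriv (\<Delta> *\<^sub>R f y) W y + (sqrt \<Delta>)\<^sup>2 / 2 * ?H + C0 * W y * \<eta> ^ 4 * (1 + \<eta>) ^ q * M
          \<le> (1 + C * \<Delta>) * W y"
        using drift unfolding C_def by (simp add: algebra_simps)
    qed
    finally show ?thesis .
  qed
  ultimately show ?thesis
    unfolding G_def W_def by blast
qed

section \<open>Truncation, adaptedness and independent increments\<close>

lemma truncation_eq:
  fixes x :: "real^'d::finite" and \<phi> :: "real \<Rightarrow> real" and K \<Delta> \<theta> :: real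
  defines "R \<equiv> inv_into {0..} \<phi> (K * \<Delta> powr (- \<theta>))"
  assumes "0 \<le> R"
  shows "truncation \<phi> K \<theta> \<Delta> x = (if norm x \<le> R then x else (R / norm x) *\<^sub>R x)"
  using assms unfolding truncation_def R_def[symmetric]
  by (cases "x = 0") (auto simp: min_def divide_inverse)

lemma norm_truncation_le:
  fixes x :: "real^'d::finite"
  assumes "0 \<le> inv_into {0..} \<phi> (K * \<Delta> powr (- \<theta>))"
  shows "norm (truncation \<phi> K \<theta> \<Delta> x) \<le> inv_into {0..} \<phi> (K * \<Delta> powr (- \<theta>))"
  unfolding truncation_eq[OF assms] using assms by auto

lemma truncation_decreases:
  fixes V :: "real^'d::finite \<Rightarrow> real"
  assumes "0 < inv_into {0..} \<phi> (K * \<Delta> powr (- \<theta>))"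
    and "\<And>x \<epsilon>. 0 < \<epsilon> \<Longrightarrow> \<epsilon> \<le> 1 \<Longrightarrow> V (\<epsilon> *\<^sub>R x) \<le> V x"
  shows "V (truncation \<phi> K \<theta> \<Delta> x) \<le> V x"
  unfolding truncation_eq[OF less_imp_le[OF assms(1)]]
proof (split if_split, intro conjI impI order_refl)
  assume "\<not> norm x \<le> inv_into {0..} \<phi> (K * \<Delta> powr (- \<theta>))"
  with assms(1) show "V ((inv_into {0..} \<phi> (K * \<Delta> powr (- \<theta>)) / norm x) *\<^sub>R x) \<le> V x"
    by (intro assms(2)) (auto simp: divide_simps)
qed

lemma local_lipschitz_continuous:
  fixes h :: "'a::metric_space \<Rightarrow> 'b::metric_space"
  assumes "local_lipschitz (UNIV :: real set) UNIV (\<lambda>_. h)"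
  shows "continuous_on UNIV h"
proof (rule continuous_at_imp_continuous_on, rule ballI)
  fix x
  from local_lipschitzE[OF assms, of 0 x] obtain u L where u: "0 < u"
    "\<And>s. s \<in> cball 0 u \<inter> (UNIV :: real set) \<Longrightarrow> L-lipschitz_on (cball x u \<inter> UNIV) h" by blast
  from u(2)[of 0] u(1) have "L-lipschitz_on (cball x u) h" by simp
  then have "continuous_on (cball x u) h"
    by (rule lipschitz_on_continuous_on)
  then have "continuous_on (ball x u) h"
    by (rule continuous_on_subset) (rule ball_subset_cball)
  then show "isCont h x"
    using u(1) by (simp add: continuous_on_eq_continuous_at)
qed

context
  fixes M :: "'a measure" and F :: "real \<Rightarrow> 'a measure" and B :: "real \<Rightarrow> 'a \<Rightarrow> real^'m::finite"
  assumes fps: "filtered_prob_space_usual M F" and BM: "brownian_motion M F B"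
begin

interpretation prob_space M
  using fps unfolding filtered_prob_space_usual_def by (elim conjE)

lemma subalgebra_filtration:
  assumes "0 \<le> t"
  shows "subalgebra M (F t)"
proof -
  have "\<forall>t\<ge>0. subalgebra M (F t)"
    using fps unfolding filtered_prob_space_usual_def by (elim conjE)
  with assms show ?thesis by blast
qed

lemma measurable_filtration_mono:
  assumes "0 \<le> s" "s \<le> t" "X \<in> borel_measurable (F s)"
  shows "X \<in> borel_measurable (F t)"
proof (rule measurable_from_subalg[OF _ assms(3)])
  have "\<forall>s t. 0 \<le> s \<and> s \<le> t \<longrightarrow> sets (F s) \<subseteq> sets (F t)"
    using fps unfolding filtered_prob_space_usual_def by (elim conjE)
  with assms(1,2) have "sets (F s) \<subseteq> sets (F t)" by blast
  then show "subalgebra (F t) (F s)"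
    using subalgebra_filtration[of s] subalgebra_filtration[of t] assms(1,2)
    unfolding subalgebra_def by simp
qed

lemma measurable_filtration_imp:
  assumes "0 \<le> s" "X \<in> borel_measurable (F s)"
  shows "X \<in> borel_measurable M"
  by (rule measurable_from_subalg[OF subalgebra_filtration[OF assms(1)] assms(2)])

lemma Brownian_adapted: "0 \<le> t \<Longrightarrow> B t \<in> borel_measurable (F t)"
  using BM unfolding brownian_motion_def by blast

lemma distr_increment:
  assumes "0 \<le> s" "s < t"
  shows "distr M borel (\<lambda>\<omega>. B t \<omega> - B s \<omega>) = gauss (sqrt (t - s))"
proof -
  have "distributed M lborel (\<lambda>\<omega>. B t \<omega> - B s \<omega>)
          (\<lambda>x. ennreal (\<Prod>i\<in>UNIV. normal_density 0 (sqrt (t - s)) (x $ i)))"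
    using BM assms unfolding brownian_motion_def by blast
  from distributed_distr_eq_density[OF this] show ?thesis
    unfolding gauss_def using distr_cong[of M M borel lborel "\<lambda>\<omega>. B t \<omega> - B s \<omega>"] by simp
qed

text \<open>
  Independence turns the joint law of the past and the increment into a product measure, so that
  the increment can be integrated out with the past held fixed.
\<close>

lemma nn_integral_increment:
  fixes X :: "'a \<Rightarrow> real^'d::finite" and h :: "(real^'d) \<times> (real^'m) \<Rightarrow> ennreal"
  assumes st: "0 \<le> s" "s < t" and X: "X \<in> borel_measurable (F s)"
    and h [measurable]: "h \<in> borel_measurable borel"
  shows "(\<integral>\<^sup>+\<omega>. h (X \<omega>, B t \<omega> - B s \<omega>) \<partial>M) = (\<integral>\<^sup>+\<omega>. (\<integral>\<^sup>+z. h (X \<omega>, z) \<partial>gauss (sqrt (t - s))) \<partial>M)"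
proof -
  let ?Z = "\<lambda>\<omega>. B t \<omega> - B s \<omega>"
  have [measurable]: "X \<in> borel_measurable M" "B t \<in> borel_measurable M" "B s \<in> borel_measurable M"
    using measurable_filtration_imp[OF st(1) X] measurable_filtration_imp[OF _ Brownian_adapted] st
    by simp_all
  have space: "space (F s) = space M"
    using subalgebra_filtration[OF st(1)] by (simp add: subalgebra_def)
  have h' [measurable]: "h \<in> borel_measurable (borel \<Otimes>\<^sub>M borel)"
    using h by (simp add: borel_prod)
  have indep: "indep_set (sets (F s)) {?Z -` A \<inter> space M | A. A \<in> sets borel}"
    using BM st unfolding brownian_motion_def by blast
  interpret N: prob_space "gauss (sqrt (t - s)) :: (real^'m) measure"
    using st by (intro prob_space_gauss) simp
  interpret X: prob_space "distr M borel X"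
    by (rule prob_space_distr) measurable
  have D: "distr M borel X \<Otimes>\<^sub>M gauss (sqrt (t - s)) = distr M (borel \<Otimes>\<^sub>M borel) (\<lambda>\<omega>. (X \<omega>, ?Z \<omega>))"
  proof (rule pair_measure_eqI)
    fix A :: "(real^'d) set" and C :: "(real^'m) set"
    assume "A \<in> sets (distr M borel X)" "C \<in> sets (gauss (sqrt (t - s)))"
    then have [measurable]: "A \<in> sets borel" "C \<in> sets borel" by simp_all
    have "prob ((X -` A \<inter> space M) \<inter> (?Z -` C \<inter> space M)) =
        prob (X -` A \<inter> space M) * prob (?Z -` C \<inter> space M)"
    proof (rule indep_setD[OF indep])
      show "X -` A \<inter> space M \<in> sets (F s)"
        using measurable_sets[OF X, of A] by (simp add: space)
    qed auto
    then show "emeasure (distr M borel X) A * emeasure (gauss (sqrt (t - s))) C =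
        emeasure (distr M (borel \<Otimes>\<^sub>M borel) (\<lambda>\<omega>. (X \<omega>, ?Z \<omega>))) (A \<times> C)"
      unfolding distr_increment[OF st, symmetric]
      by (simp add: emeasure_distr emeasure_eq_measure vimage_Times Int_ac flip: ennreal_mult)
         (simp add: vimage_def Int_def conj_ac)
  qed (auto intro: X.sigma_finite_measure_axioms N.sigma_finite_measure_axioms cong: sets_pair_measure_cong)
  have "(\<integral>\<^sup>+\<omega>. h (X \<omega>, ?Z \<omega>) \<partial>M) = (\<integral>\<^sup>+p. h p \<partial>distr M (borel \<Otimes>\<^sub>M borel) (\<lambda>\<omega>. (X \<omega>, ?Z \<omega>)))"
    by (rule nn_integral_distr[symmetric]) measurable
  also have "\<dots> = (\<integral>\<^sup>+x. (\<integral>\<^sup>+z. h (x, z) \<partial>gauss (sqrt (t - s))) \<partial>distr M borel X)"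
    unfolding D[symmetric] by (rule N.nn_integral_fst[symmetric]) measurable
  also have "\<dots> = (\<integral>\<^sup>+\<omega>. (\<integral>\<^sup>+z. h (X \<omega>, z) \<partial>gauss (sqrt (t - s))) \<partial>M)"
    by (rule nn_integral_distr) measurable
  finally show ?thesis .
qed

lemma truncated_EM_adapted:
  fixes f :: "real^'d::finite \<Rightarrow> real^'d" and g :: "real^'d \<Rightarrow> real^'m^'d"
  assumes f: "continuous_on UNIV f" and g: "continuous_on UNIV g" and "0 \<le> \<Delta>"
  shows "truncated_EM f g B x0 \<phi> K \<theta> \<Delta> k \<in> borel_measurable (F (real k * \<Delta>))"
proof (induction k)
  case (Suc k)
  let ?t = "real (Suc k) * \<Delta>" and ?s = "real k * \<Delta>"
  have st: "0 \<le> ?s" "?s \<le> ?t" using assms(3) by (auto simp: mult_right_mono)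
  have [measurable]: "f \<in> borel_measurable borel" "g \<in> borel_measurable borel"
    using f g by (auto intro: borel_measurable_continuous_onI)
  have [measurable]: "truncated_EM f g B x0 \<phi> K \<theta> \<Delta> k \<in> borel_measurable (F ?t)"
      "B ?s \<in> borel_measurable (F ?t)" "B ?t \<in> borel_measurable (F ?t)"
    using Suc st Brownian_adapted by (auto intro: measurable_filtration_mono order_trans)
  have [measurable]: "(\<lambda>p :: (real^'m^'d) \<times> (real^'m). fst p *v snd p) \<in> borel_measurable borel"
    unfolding matrix_vector_mult_def
    by (intro borel_measurable_continuous_onI continuous_intros)
  have trunc: "truncation \<phi> K \<theta> \<Delta> \<in> borel_measurable borel"
    unfolding truncation_def by measurable
  have "(\<lambda>\<omega>. (\<lambda>p. fst p *v snd p) (g (truncated_EM f g B x0 \<phi> K \<theta> \<Delta> k \<omega>), B ?t \<omega> - B ?s \<omega>))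
      \<in> borel_measurable (F ?t)"
    by measurable
  then have [measurable]: "(\<lambda>\<omega>. g (truncated_EM f g B x0 \<phi> K \<theta> \<Delta> k \<omega>) *v (B ?t \<omega> - B ?s \<omega>))
      \<in> borel_measurable (F ?t)"
    by simp
  have "(\<lambda>\<omega>. truncated_EM f g B x0 \<phi> K \<theta> \<Delta> k \<omega> + \<Delta> *\<^sub>R f (truncated_EM f g B x0 \<phi> K \<theta> \<Delta> k \<omega>)
      + g (truncated_EM f g B x0 \<phi> K \<theta> \<Delta> k \<omega>) *v (B ?t \<omega> - B ?s \<omega>)) \<in> borel_measurable (F ?t)"
    by measurable
  from measurable_compose[OF this trunc]
  have "(\<lambda>\<omega>. truncated_EM f g B x0 \<phi> K \<theta> \<Delta> (Suc k) \<omega>) \<in> borel_measurable (F ?t)"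
    unfolding truncated_EM.simps(2) Let_def .
  then show ?case .
qed simp

end

section \<open>Moment bound for the truncated scheme\<close>

text \<open>
  The scheme never leaves the ball of radius \<open>R\<close>, so the one-step estimate is needed on that ball
  only. This is the purpose of the truncation: on the ball the growth of \<open>f\<close> and \<open>g\<close> is
  controlled by the step size.
\<close>

lemma truncated_EM_moment_bound:
  fixes M :: "'a measure" and F :: "real \<Rightarrow> 'a measure" and B :: "real \<Rightarrow> 'a \<Rightarrow> real^'m::finite"
    and f :: "real^'d::finite \<Rightarrow> real^'d" and g :: "real^'d \<Rightarrow> real^'m^'d" and x0 :: "real^'d"
    and W :: "real^'d \<Rightarrow> real" and \<phi> :: "real \<Rightarrow> real" and K \<theta> \<Delta> :: real
  defines "R \<equiv> inv_into {0..} \<phi> (K * \<Delta> powr (- \<theta>))"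
  assumes fps: "filtered_prob_space_usual M F" and BM: "brownian_motion M F B"
    and cont: "continuous_on UNIV f" "continuous_on UNIV g"
    and W [measurable]: "W \<in> borel_measurable borel" and W0: "\<And>x. 0 \<le> W x"
    and trunc: "\<And>x. W (truncation \<phi> K \<theta> \<Delta> x) \<le> W x"
    and R: "norm x0 \<le> R" and \<Delta>: "0 < \<Delta>" and C: "0 \<le> C"
    and step: "\<And>y. norm y \<le> R \<Longrightarrow>
      (\<integral>\<^sup>+z. ennreal (W (y + \<Delta> *\<^sub>R f y + g y *v z)) \<partial>gauss (sqrt \<Delta>)) \<le> ennreal ((1 + C * \<Delta>) * W y)"
  shows "(\<integral>\<^sup>+\<omega>. ennreal (W (truncated_EM f g B x0 \<phi> K \<theta> \<Delta> k \<omega>)) \<partial>M) \<le> ennreal ((1 + C * \<Delta>) ^ k * W x0)"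
proof (induction k)
  case 0
  interpret prob_space M
    using fps unfolding filtered_prob_space_usual_def by (elim conjE)
  show ?case by (simp add: emeasure_space_1)
next
  case (Suc k)
  let ?Y = "truncated_EM f g B x0 \<phi> K \<theta> \<Delta> k"
  let ?t = "real (Suc k) * \<Delta>" and ?s = "real k * \<Delta>"
  have R0: "0 \<le> R" using R norm_ge_zero order_trans by blast
  have st: "0 \<le> ?s" "?s < ?t" "?t - ?s = \<Delta>" using \<Delta> by (auto simp: algebra_simps)
  have YR: "norm (?Y \<omega>) \<le> R" for \<omega>
    using R norm_truncation_le[OF R0[unfolded R_def]] by (cases k) (auto simp: Let_def R_def)
  have Y: "?Y \<in> borel_measurable (F ?s)"
    using truncated_EM_adapted[OF fps BM cont] \<Delta> by simp
  from measurable_filtration_imp[OF fps BM st(1) this] have [measurable]: "?Y \<in> borel_measurable M" .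
  have [measurable]: "f \<in> borel_measurable borel" "g \<in> borel_measurable borel"
    using cont by (auto intro: borel_measurable_continuous_onI)
  have [measurable]: "(\<lambda>p :: (real^'m^'d) \<times> (real^'m). fst p *v snd p) \<in> borel_measurable (borel \<Otimes>\<^sub>M borel)"
    unfolding matrix_vector_mult_def borel_prod
    by (intro borel_measurable_continuous_onI continuous_intros)
  have "(\<lambda>p :: (real^'d) \<times> (real^'m). (\<lambda>p. fst p *v snd p) (g (fst p), snd p))
      \<in> borel_measurable (borel \<Otimes>\<^sub>M borel)"
    by measurable
  then have [measurable]: "(\<lambda>p :: (real^'d) \<times> (real^'m). g (fst p) *v snd p)
      \<in> borel_measurable (borel \<Otimes>\<^sub>M borel)"
    by simp
  let ?h = "\<lambda>p :: (real^'d) \<times> (real^'m). ennreal (W (fst p + \<Delta> *\<^sub>R f (fst p) + g (fst p) *v snd p))"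
  have "?h \<in> borel_measurable (borel \<Otimes>\<^sub>M borel)"
    by measurable
  then have h: "?h \<in> borel_measurable borel"
    unfolding borel_prod .
  have "(\<integral>\<^sup>+\<omega>. ennreal (W (truncated_EM f g B x0 \<phi> K \<theta> \<Delta> (Suc k) \<omega>)) \<partial>M) \<le>
      (\<integral>\<^sup>+\<omega>. ?h (?Y \<omega>, B ?t \<omega> - B ?s \<omega>) \<partial>M)"
    unfolding truncated_EM.simps(2) Let_def fst_conv snd_conv
    by (intro nn_integral_mono ennreal_leI trunc)
  also have "\<dots> = (\<integral>\<^sup>+\<omega>. (\<integral>\<^sup>+z. ?h (?Y \<omega>, z) \<partial>gauss (sqrt (?t - ?s))) \<partial>M)"
    by (rule nn_integral_increment[OF fps BM st(1,2) Y h])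
  also have "\<dots> \<le> (\<integral>\<^sup>+\<omega>. ennreal ((1 + C * \<Delta>) * W (?Y \<omega>)) \<partial>M)"
    unfolding st(3) fst_conv snd_conv by (intro nn_integral_mono step YR)
  also have "\<dots> = ennreal (1 + C * \<Delta>) * (\<integral>\<^sup>+\<omega>. ennreal (W (?Y \<omega>)) \<partial>M)"
    using C \<Delta> W0 by (simp add: ennreal_mult nn_integral_cmult)
  also have "\<dots> \<le> ennreal (1 + C * \<Delta>) * ennreal ((1 + C * \<Delta>) ^ k * W x0)"
    by (rule mult_left_mono[OF Suc.IH]) simp
  also have "\<dots> = ennreal ((1 + C * \<Delta>) ^ Suc k * W x0)"
    by (subst ennreal_mult[symmetric]) (use C \<Delta> W0 in \<open>auto simp: mult.assoc\<close>)
  finally show ?case .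
qed

theorem theorem3p3:
  fixes M :: "'a measure" and F :: "real \<Rightarrow> 'a measure"
    and B :: "real \<Rightarrow> 'a \<Rightarrow> real^'m::finite"
    and f :: "real^'d::finite \<Rightarrow> real^'d" and g :: "real^'d \<Rightarrow> real^'m^'d" and x0 :: "real^'d"
    and V :: "real^'d \<Rightarrow> real" and \<phi> :: "real \<Rightarrow> real"
    and \<delta>\<^sub>4 \<rho> lam \<theta> \<Delta>star K :: real
  assumes "filtered_prob_space_usual M F"
    and "brownian_motion M F B"
    and "local_lipschitz (UNIV :: real set) UNIV (\<lambda>_. f)"
    and "local_lipschitz (UNIV :: real set) UNIV (\<lambda>_. g)"
    and "1 / \<delta>\<^sub>4 \<in> \<int>" and "1 / \<delta>\<^sub>4 \<ge> 4"
    and "V \<in> lyapunov_class 4 \<delta>\<^sub>4"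
    and "strict_mono_on {0..} \<phi>" and "continuous_on {0..} \<phi>" and "\<forall>u\<ge>0. \<phi> u \<ge> 0"
    and "filterlim \<phi> at_top at_top"
    and "\<forall>u\<ge>1. (SUP x\<in>cball 0 u. ereal (max (norm (f x) / (1 + V x) powr \<delta>\<^sub>4)
                     ((norm (g x))\<^sup>2 / (1 + V x) powr (2 * \<delta>\<^sub>4)))) \<le> ereal (\<phi> u)"
    and "0 < \<theta>" and "\<theta> \<le> 1 / 2"
    and "0 < \<Delta>star" and "\<Delta>star \<le> 1" and "K > 0"
    and "K * \<Delta>star powr (- \<theta>) \<ge> \<phi> (max (norm x0) 1)"
    and "\<rho> > 0" and "lam > 0"
    and "\<forall>x. \<rho> / 2 * (1 + V x) powr (\<rho> - 2) *
              (2 * (1 + V x) * generator f g V x + (\<rho> - 1) * (norm (gradient V x v* g x))\<^sup>2)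
            \<le> lam * (1 + V x powr \<rho>)"
    and "\<forall>x \<epsilon>. 0 < \<epsilon> \<and> \<epsilon> \<le> 1 \<longrightarrow> V (\<epsilon> *\<^sub>R x) \<le> V x"
  shows "\<forall>T>0. \<exists>C>0. (SUP \<Delta>\<in>{0<..\<Delta>star}. SUP k\<in>{k :: nat. real k * \<Delta> \<le> T}.
            \<integral>\<^sup>+\<omega>. ennreal (V (truncated_EM f g B x0 \<phi> K \<theta> \<Delta> k \<omega>) powr \<rho>) \<partial>M) \<le> ennreal C"
proof (intro allI impI)
  fix T :: real assume "T > 0"
  have \<delta>: "0 < \<delta>\<^sub>4"
  proof -
    have "0 < 1 / \<delta>\<^sub>4" using assms(6) by linarith
    then show ?thesis by simp
  qed
  have V0: "0 \<le> V x" for x using assms(7) by (simp add: lyapunov_class_def)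
  define W where "W = (\<lambda>x. (1 + V x) powr \<rho>)"
  have "continuous_on UNIV V"
    using assms(7) by (intro C_diff_continuous[of 4]) (simp add: lyapunov_class_def del: C_diff.simps)
  then have [measurable]: "V \<in> borel_measurable borel"
    by (rule borel_measurable_continuous_onI)
  have Wm: "W \<in> borel_measurable borel"
    unfolding W_def by measurable
  have W1: "1 \<le> W x" for x
    unfolding W_def using V0[of x] assms(19) by (intro ge_one_powr_ge_zero) auto
  obtain C where C: "0 \<le> C" and step: "\<And>\<Delta> h y. 0 < \<Delta> \<Longrightarrow> \<Delta> \<le> 1 \<Longrightarrow> 0 \<le> h \<Longrightarrow> h\<^sup>2 * \<Delta> \<le> K\<^sup>2 \<Longrightarrow>
      norm (f y) \<le> h * (1 + V y) powr \<delta>\<^sub>4 \<Longrightarrow> (norm (g y))\<^sup>2 \<le> h * ((1 + V y) powr \<delta>\<^sub>4)\<^sup>2 \<Longrightarrow>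
      (\<integral>\<^sup>+z. ennreal (W (y + \<Delta> *\<^sub>R f y + g y *v z)) \<partial>gauss (sqrt \<Delta>)) \<le> ennreal ((1 + C * \<Delta>) * W y)"
    unfolding W_def
    using one_step_moment_bound[OF assms(7) \<delta> assms(19,20,17), of f g] assms(21) by blast
  have bound: "(\<integral>\<^sup>+\<omega>. ennreal (V (truncated_EM f g B x0 \<phi> K \<theta> \<Delta> k \<omega>) powr \<rho>) \<partial>M) \<le> ennreal (exp (C * T) * W x0)"
    if \<Delta>: "0 < \<Delta>" "\<Delta> \<le> \<Delta>star" and k: "real k * \<Delta> \<le> T" for \<Delta> k
  proof -
    \<comment> \<open>The radius \<open>?R\<close> of the truncation is where \<open>\<phi>\<close> takes the value \<open>?h\<close>; it is at least 1, so the growth condition on \<open>f\<close> and \<open>g\<close> applies at \<open>u = ?R\<close>.\<close>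
    let ?h = "K * \<Delta> powr (- \<theta>)"
    let ?R = "inv_into {0..} \<phi> ?h"
    let ?r0 = "max (norm x0) 1"
    have \<Delta>1: "\<Delta> \<le> 1" using \<Delta>(2) assms(16) by simp
    have "\<Delta>star powr (- \<theta>) \<le> \<Delta> powr (- \<theta>)"
      using \<Delta> assms(13) by (intro powr_mono2') auto
    then have "K * \<Delta>star powr (- \<theta>) \<le> ?h"
      using assms(17) by (intro mult_left_mono) auto
    then have r0h: "\<phi> ?r0 \<le> ?h" using assms(18) by simp
    have h: "0 \<le> ?h" "?h\<^sup>2 * \<Delta> \<le> K\<^sup>2"
    proof -
      have "(\<Delta> powr (- \<theta>))\<^sup>2 * \<Delta> = \<Delta> powr (- \<theta>) * \<Delta> powr (- \<theta>) * \<Delta> powr 1"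
        using \<Delta>(1) by (simp add: power2_eq_square)
      also have "\<dots> = \<Delta> powr (1 - 2 * \<theta>)"
        unfolding powr_add[symmetric] by (simp add: algebra_simps)
      also have "\<dots> \<le> 1" using \<Delta>(1) \<Delta>1 assms(14) by (intro powr_le1) auto
      finally have "K\<^sup>2 * ((\<Delta> powr (- \<theta>))\<^sup>2 * \<Delta>) \<le> K\<^sup>2 * 1" by (intro mult_left_mono) auto
      then show "?h\<^sup>2 * \<Delta> \<le> K\<^sup>2" by (simp add: power_mult_distrib mult.assoc)
    qed (use assms(17) in simp)
    have "?h \<in> \<phi> ` {0..}"
    proof -
      have ev: "eventually (\<lambda>u. ?h \<le> \<phi> u \<and> ?r0 \<le> u) at_top"
        using assms(11) by (intro eventually_conj eventually_ge_at_top) (simp add: filterlim_at_top)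
      then obtain u where u: "?h \<le> \<phi> u" "?r0 \<le> u"
        using eventually_happens'[OF trivial_limit_at_top_linorder ev] by blast
      have "continuous_on {?r0..u} \<phi>"
        by (rule continuous_on_subset[OF assms(9)]) auto
      from IVT'[OF r0h u(1) u(2) this] obtain x where "?r0 \<le> x" "\<phi> x = ?h" by blast
      then show ?thesis by (intro image_eqI[of _ _ x]) auto
    qed
    then have R: "\<phi> ?R = ?h" "0 \<le> ?R"
      using f_inv_into_f[of ?h \<phi> "{0..}"] inv_into_into[of ?h \<phi> "{0..}"] by simp_all
    have r0R: "?r0 \<le> ?R"
    proof (rule ccontr)
      assume "\<not> ?r0 \<le> ?R"
      then have "\<phi> ?R < \<phi> ?r0"
        using R(2) by (intro strict_mono_onD[OF assms(8)]) auto
      with R(1) r0h show False by simp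
    qed
    have growth: "norm (f y) \<le> ?h * (1 + V y) powr \<delta>\<^sub>4" "(norm (g y))\<^sup>2 \<le> ?h * ((1 + V y) powr \<delta>\<^sub>4)\<^sup>2"
      if y: "norm y \<le> ?R" for y
    proof -
      have "(SUP x\<in>cball 0 ?R. ereal (max (norm (f x) / (1 + V x) powr \<delta>\<^sub>4)
                     ((norm (g x))\<^sup>2 / (1 + V x) powr (2 * \<delta>\<^sub>4)))) \<le> ereal ?h"
        using assms(12) r0R R(1) by auto
      then have "norm (f y) / (1 + V y) powr \<delta>\<^sub>4 \<le> ?h" "(norm (g y))\<^sup>2 / (1 + V y) powr (2 * \<delta>\<^sub>4) \<le> ?h"
        using y by (auto simp: SUP_le_iff)
      moreover have "0 < (1 + V y) powr \<delta>\<^sub>4" using V0[of y] by simp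
      moreover have "(1 + V y) powr (2 * \<delta>\<^sub>4) = ((1 + V y) powr \<delta>\<^sub>4)\<^sup>2"
        by (simp add: power2_eq_square powr_add[symmetric])
      ultimately show "norm (f y) \<le> ?h * (1 + V y) powr \<delta>\<^sub>4" "(norm (g y))\<^sup>2 \<le> ?h * ((1 + V y) powr \<delta>\<^sub>4)\<^sup>2"
        by (simp_all add: pos_divide_le_eq)
    qed
    have "V (truncation \<phi> K \<theta> \<Delta> x) \<le> V x" for x
      by (rule truncation_decreases) (use r0R assms(22) in auto)
    then have trunc: "W (truncation \<phi> K \<theta> \<Delta> x) \<le> W x" for x
      unfolding W_def using V0 assms(19) by (intro powr_mono2) (auto intro: add_nonneg_nonneg)
    have "V y powr \<rho> \<le> W y" for y
      unfolding W_def using V0[of y] assms(19) by (intro powr_mono2) auto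
    then have "(\<integral>\<^sup>+\<omega>. ennreal (V (truncated_EM f g B x0 \<phi> K \<theta> \<Delta> k \<omega>) powr \<rho>) \<partial>M) \<le>
        (\<integral>\<^sup>+\<omega>. ennreal (W (truncated_EM f g B x0 \<phi> K \<theta> \<Delta> k \<omega>)) \<partial>M)"
      by (intro nn_integral_mono ennreal_leI)
    also have "\<dots> \<le> ennreal ((1 + C * \<Delta>) ^ k * W x0)"
    proof (rule truncated_EM_moment_bound[OF assms(1,2) _ _ Wm _ trunc _ \<Delta>(1) C])
      show "norm x0 \<le> ?R" using r0R by simp
      show "0 \<le> W x" for x using W1[of x] by simp
      show "(\<integral>\<^sup>+z. ennreal (W (y + \<Delta> *\<^sub>R f y + g y *v z)) \<partial>gauss (sqrt \<Delta>)) \<le> ennreal ((1 + C * \<Delta>) * W y)"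
        if "norm y \<le> ?R" for y
        by (rule step[OF \<Delta>(1) \<Delta>1 h growth[OF that]])
    qed (rule local_lipschitz_continuous[OF assms(3)] local_lipschitz_continuous[OF assms(4)])+
    also have "\<dots> \<le> ennreal (exp (C * T) * W x0)"
    proof (rule ennreal_leI)
      have "(1 + C * \<Delta>) ^ k \<le> exp (C * \<Delta>) ^ k"
        using C \<Delta>(1) by (intro power_mono) auto
      also have "\<dots> = exp (C * (real k * \<Delta>))"
        by (simp add: exp_of_nat_mult[symmetric] mult_ac)
      also have "\<dots> \<le> exp (C * T)"
        using C k by (simp add: mult_left_mono)
      finally show "(1 + C * \<Delta>) ^ k * W x0 \<le> exp (C * T) * W x0"
        using W1[of x0] by (intro mult_right_mono) auto
    qed
    finally show ?thesis .
  qed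
  show "\<exists>C>0. (SUP \<Delta>\<in>{0<..\<Delta>star}. SUP k\<in>{k :: nat. real k * \<Delta> \<le> T}.
            \<integral>\<^sup>+\<omega>. ennreal (V (truncated_EM f g B x0 \<phi> K \<theta> \<Delta> k \<omega>) powr \<rho>) \<partial>M) \<le> ennreal C"
  proof (intro exI conjI)
    show "0 < exp (C * T) * W x0" using W1[of x0] by simp
    show "(SUP \<Delta>\<in>{0<..\<Delta>star}. SUP k\<in>{k :: nat. real k * \<Delta> \<le> T}.
            \<integral>\<^sup>+\<omega>. ennreal (V (truncated_EM f g B x0 \<phi> K \<theta> \<Delta> k \<omega>) powr \<rho>) \<partial>M) \<le> ennreal (exp (C * T) * W x0)"
      by (intro SUP_least bound) auto
  qed
qed

end
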